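(* Let $k\ge4$ be even and let $\widehat\Psi$, $\Omega$, $\Theta_1$, $\Theta^*$ and the lowering operators be as in the context. Then: (1) $L_z\left(\widehat\Psi(\tau,z)\right)=\Theta_1(\tau,z)$; (2) $y^{-2k}L_\tau\left(\widehat\Psi(\tau,z)\right)=\frac{i}{\beta(k-\frac12,\frac12)}\,\Omega(-\overline{\tau},z)-\Theta^*(\tau,z)$.
   Context: Let $k\geq 4$ be an even integer. For $D\in\mathbb{Z}$ let $\mathcal{Q}_D$ be the set of integral binary quadratic forms $Q=[a,b,c]$, $Q(X,Y)=aX^2+bXY+cY^2$ with $a,b,c\in\mathbb{Z}$ and $b^2-4ac=D$. Write $\tau=x+iy$, $z=u+iv\in\mathbb{H}$. For $Q=[a,b,c]$ put $Q(\tau,1)=a\tau^2+b\tau+c$ and $Q_\tau:=\frac1y\left(a|\tau|^2+bx+c\right)$; $\operatorname{sgn}$ is the sign function with $\operatorname{sgn}(0)=0$. Let $\beta(v;s,w):=\int_0^v t^{s-1}(1-t)^{w-1}dt$, $\beta(s,w):=\beta(1;s,w)$, $\psi_k(v):=\frac12\beta(v;k-\frac12,\frac12)$, and $\Gamma(s;w):=\int_w^\infty t^{s-1}e^{-t}dt$. For $D>0$ define $\mathcal{F}_D(\tau):=\frac{2}{\beta(k-\frac12,\frac12)}\sum_{Q\in\mathcal{Q}_D}\operatorname{sgn}(Q_\tau)Q(\tau,1)^{k-1}\psi_k\!\left(\frac{Dy^2}{|Q(\tau,1)|^2}\right)$, and for $D\in\mathbb{Z}$ define $\mathcal{G}_D(v;\tau):=-\frac{1}{\sqrt\pi}\sum_{Q\in\mathcal{Q}_D}\operatorname{sgn}(Q_\tau)Q(\tau,1)^{k-1}\Gamma\!\left(\frac12;4\pi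 Q_\tau^2v\right)$. Let $\Psi(\tau,z):=\sum_{D>0}\mathcal{F}_D(\tau)e^{2\pi iDz}$, $\Psi^*(\tau,z):=\sum_{D\in\mathbb{Z}}\mathcal{G}_D(v;\tau)e^{2\pi iDz}$ and $\widehat\Psi:=\Psi+\Psi^*$. For $D>0$ let $f_D(\tau):=D^{k-\frac12}\sum_{Q\in\mathcal{Q}_D}Q(\tau,1)^{-k}$ and $\Omega(\tau,z):=\sum_{D>0}f_D(\tau)e^{2\pi iDz}$. Define $\Theta_1(\tau,z):=iv^{\frac32}\sum_{D\in\mathbb{Z}}\sum_{Q\in\mathcal{Q}_D}Q(\tau,1)^{k-1}Q_\tau e^{-4\pi Q_\tau^2v}e^{2\pi iDz}$ and $\Theta^*(\tau,z):=2iv^{\frac12}y^{-2k}\sum_{D\in\mathbb{Z}}\sum_{Q\in\mathcal{Q}_D}Q(\tau,1)^{k}e^{-4\pi Q_\tau^2v}e^{2\pi iDz}$. For a variable $w\in\mathbb{H}$ the lowering operator is $L_w:=\operatorname{Im}(w)^2\frac{\partial}{\partial\overline{w}}$. *)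

theory Defs
  imports "HOL-Analysis.Analysis"
begin

text \<open>The triple \<open>(a, b, c)\<close> stands for the form \<open>[a,b,c] = aX^2 + bXY + cY^2\<close>.\<close>

type_synonym qform = "int \<times> int \<times> int"

definition forms_of_disc :: "int \<Rightarrow> qform set" where
  "forms_of_disc D = {(a, b, c). b\<^sup>2 - 4 * a * c = D}"

text \<open>\<open>qeval Q \<tau>\<close> is \<open>Q(\<tau>,1)\<close>, and \<open>qtau Q \<tau>\<close> is the real number \<open>Q\<close> with subscript \<open>\<tau>\<close>.\<close>

definition qeval :: "qform \<Rightarrow> complex \<Rightarrow> complex" where
  "qeval Q \<tau> = (case Q of (a, b, c) \<Rightarrow> of_int a * \<tau>\<^sup>2 + of_int b * \<tau> + of_int c)"

definition qtau :: "qform \<Rightarrow> complex \<Rightarrow> real" where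
  "qtau Q \<tau> = (case Q of (a, b, c) \<Rightarrow>
     (of_int a * (cmod \<tau>)\<^sup>2 + of_int b * Re \<tau> + of_int c) / Im \<tau>)"

definition inc_beta :: "real \<Rightarrow> real \<Rightarrow> real \<Rightarrow> real" where
  "inc_beta v s w = integral {0..v} (\<lambda>t. t powr (s - 1) * (1 - t) powr (w - 1))"

definition beta_fun :: "real \<Rightarrow> real \<Rightarrow> real" where
  "beta_fun s w = inc_beta 1 s w"

definition psi :: "nat \<Rightarrow> real \<Rightarrow> real" where
  "psi k v = inc_beta v (real k - 1/2) (1/2) / 2"

definition inc_Gamma :: "real \<Rightarrow> real \<Rightarrow> real" where
  "inc_Gamma s w = integral {w..} (\<lambda>t. t powr (s - 1) * exp (- t))"

definition qexp :: "int \<Rightarrow> complex \<Rightarrow> complex" where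
  "qexp D z = exp (2 * of_real pi * \<i> * of_int D * z)"

text \<open>All series below are sums in the sense of unconditional summation, which for complex
  series is the same as absolute convergence. The functions \<open>local_form\<close> and \<open>hyp_poincare\<close>,
  written calligraphic \<open>F\<close> and \<open>f\<close> with index \<open>D\<close> in the literature, are only meaningful
  for \<open>D > 0\<close>.\<close>

definition local_form :: "nat \<Rightarrow> int \<Rightarrow> complex \<Rightarrow> complex" where
  "local_form k D \<tau> =
     of_real (2 / beta_fun (real k - 1/2) (1/2)) *
     (\<Sum>\<^sub>\<infinity>Q\<in>forms_of_disc D. of_real (sgn (qtau Q \<tau>)) * qeval Q \<tau> ^ (k - 1) *
        of_real (psi k (of_int D * (Im \<tau>)\<^sup>2 / (cmod (qeval Q \<tau>))\<^sup>2)))"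

definition compl_form :: "nat \<Rightarrow> int \<Rightarrow> real \<Rightarrow> complex \<Rightarrow> complex" where
  "compl_form k D v \<tau> =
     of_real (- 1 / sqrt pi) *
     (\<Sum>\<^sub>\<infinity>Q\<in>forms_of_disc D. of_real (sgn (qtau Q \<tau>)) * qeval Q \<tau> ^ (k - 1) *
        of_real (inc_Gamma (1/2) (4 * pi * (qtau Q \<tau>)\<^sup>2 * v)))"

definition Psi :: "nat \<Rightarrow> complex \<Rightarrow> complex \<Rightarrow> complex" where
  "Psi k \<tau> z = (\<Sum>\<^sub>\<infinity>D\<in>{0<..}. local_form k D \<tau> * qexp D z)"

definition Psi_star :: "nat \<Rightarrow> complex \<Rightarrow> complex \<Rightarrow> complex" where
  "Psi_star k \<tau> z = (\<Sum>\<^sub>\<infinity>D\<in>UNIV. compl_form k D (Im z) \<tau> * qexp D z)"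

definition Psi_hat :: "nat \<Rightarrow> complex \<Rightarrow> complex \<Rightarrow> complex" where
  "Psi_hat k \<tau> z = Psi k \<tau> z + Psi_star k \<tau> z"

definition hyp_poincare :: "nat \<Rightarrow> int \<Rightarrow> complex \<Rightarrow> complex" where
  "hyp_poincare k D \<tau> =
     of_real (of_int D powr (real k - 1/2)) *
     (\<Sum>\<^sub>\<infinity>Q\<in>forms_of_disc D. qeval Q \<tau> powi (- int k))"

definition Omega :: "nat \<Rightarrow> complex \<Rightarrow> complex \<Rightarrow> complex" where
  "Omega k \<tau> z = (\<Sum>\<^sub>\<infinity>D\<in>{0<..}. hyp_poincare k D \<tau> * qexp D z)"

definition Theta1 :: "nat \<Rightarrow> complex \<Rightarrow> complex \<Rightarrow> complex" where
  "Theta1 k \<tau> z = \<i> * of_real (Im z powr (3/2)) *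
     (\<Sum>\<^sub>\<infinity>D\<in>UNIV. \<Sum>\<^sub>\<infinity>Q\<in>forms_of_disc D.
        qeval Q \<tau> ^ (k - 1) * of_real (qtau Q \<tau>) *
        of_real (exp (- 4 * pi * (qtau Q \<tau>)\<^sup>2 * Im z)) * qexp D z)"

definition Theta_star :: "nat \<Rightarrow> complex \<Rightarrow> complex \<Rightarrow> complex" where
  "Theta_star k \<tau> z = 2 * \<i> * of_real (Im z powr (1/2)) * of_real (Im \<tau> powi (- 2 * int k)) *
     (\<Sum>\<^sub>\<infinity>D\<in>UNIV. \<Sum>\<^sub>\<infinity>Q\<in>forms_of_disc D.
        qeval Q \<tau> ^ k * of_real (exp (- 4 * pi * (qtau Q \<tau>)\<^sup>2 * Im z)) * qexp D z)"

text \<open>The Wirtinger derivative with respect to the conjugate variable, that is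
  \<open>(\<partial>/\<partial>x + i \<partial>/\<partial>y) / 2\<close> with real partial derivatives. It is only meaningful
  where these exist.\<close>

definition dbar :: "(complex \<Rightarrow> complex) \<Rightarrow> complex \<Rightarrow> complex" where
  "dbar f w = (vector_derivative (\<lambda>x. f (Complex x (Im w))) (at (Re w)) +
     \<i> * vector_derivative (\<lambda>y. f (Complex (Re w) y)) (at (Im w))) / 2"

definition lowering :: "(complex \<Rightarrow> complex) \<Rightarrow> complex \<Rightarrow> complex" where
  "lowering f w = of_real ((Im w)\<^sup>2) * dbar f w"

end

theory Submission
  imports Defs
begin

text \<open>
  Since \<open>|Q(\<tau>,1)|\<^sup>2 = y\<^sup>2 (D + Q\<^sub>\<tau>\<^sup>2)\<close>, the substitution \<open>t = D / (D + s\<^sup>2)\<close> turns \<open>sgn(Q\<^sub>\<tau>) \<psi>\<close>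
  into \<open>sgn(Q\<^sub>\<tau>) \<beta>/2\<close> minus a smooth odd function of \<open>Q\<^sub>\<tau>\<close> with derivative
  \<open>D^(k - 1/2) / (D + Q\<^sub>\<tau>\<^sup>2)^k\<close>, and \<open>t = 4\<pi>vs\<^sup>2\<close> turns \<open>sgn(Q\<^sub>\<tau>) \<Gamma>(1/2; -)\<close> into
  \<open>sgn(Q\<^sub>\<tau>) \<surd>\<pi>\<close> minus a multiple of an error function. The sign functions
  cancel in the sum of the two for \<open>D > 0\<close>, so every term of \<open>\<Psi>\<close> hat, viewed as one series over all forms,
  is differentiable in \<open>\<tau>\<close> and \<open>z\<close>. Locally uniformly, terms and first derivatives are
  \<open>O((1 + |a| + |b| + |c|)^(-k))\<close>, which is summable over the lattice of forms as \<open>k > 3\<close>: the Gamma part decays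
  like \<open>exp (-2\<pi>v (D + 2 Q\<^sub>\<tau>\<^sup>2))\<close> with a positive definite form in the exponent, and for the
  Beta part \<open>D^n exp (-2\<pi>Dv)\<close> is bounded. The series may thus be differentiated term by term, and
  \<open>L\<^sub>\<tau> Q\<^sub>\<tau> = -i/2 Q(\<tau>,1)\<close> gives both identities.
\<close>

section \<open>The incomplete Gamma and Beta functions\<close>

text \<open>No single expression for the real factor shows everything. The defining integrals show
  decay but carry the sign of \<open>qtau\<close> in front; the primitives are smooth but tend to
  non-zero constants, so neither of them decays by itself. Both expressions are kept and equated:
  estimates come from the former, derivatives from the latter.

  The order -k is a balance of orders in h = 1 + |a| + |b| + |c|. The power
  \<open>qeval Q \<tau> ^ (k - 1)\<close> has order k - 1, and \<psi> has order 1 - 2k, since its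
  argument is O(D / h^2) and the Beta integral up to w is O(w^(k - 1/2)). Differentiation costs
  nothing: the derivative of the Beta part in \<open>qtau\<close> gains one order, and the inner
  derivative of \<open>qtau\<close> brings a factor \<open>qeval\<close> that loses it again.

  The zero form has to be set apart, because the positive definite form vanishes there; its terms
  are 0 as they contain a power of \<open>qeval\<close>. For any other form with D \<le> 0,
  positivity forces \<open>qtau\<close> to be non-zero, so the sign that survives in its term is
  locally constant in \<tau>.\<close>

definition primitive0 :: "(real \<Rightarrow> real) \<Rightarrow> real \<Rightarrow> real" where
  "primitive0 f = (SOME F. F 0 = 0 \<and> (\<forall>x. (F has_real_derivative f x) (at x)))"

text \<open>Continuity gives an antiderivative on the whole line, and subtracting its value at 0
  normalises it. It stands for the integral from 0 to x, oriented when x is negative; these two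
  properties are all that is used of it.\<close>

lemma primitive0:
  assumes "continuous_on UNIV f"
  shows primitive0_0: "primitive0 f 0 = 0"
    and primitive0_deriv: "(primitive0 f has_real_derivative f x) (at x)"
proof -
  have "\<exists>F. \<forall>x::real. -\<infinity> < ereal x \<longrightarrow> ereal x < \<infinity> \<longrightarrow> (F has_vector_derivative f x) (at x)"
    by (rule einterval_antiderivative) (use assms in \<open>auto simp: continuous_on_eq_continuous_at\<close>)
  then obtain F where F: "\<And>x. (F has_real_derivative f x) (at x)"
    by (auto simp: has_real_derivative_iff_has_vector_derivative)
  have "\<exists>F. F 0 = 0 \<and> (\<forall>x. (F has_real_derivative f x) (at x))"
    by (rule exI[of _ "\<lambda>x. F x - F 0"]) (auto intro!: derivative_eq_intros F)
  then have *: "primitive0 f 0 = 0 \<and> (\<forall>x. (primitive0 f has_real_derivative f x) (at x))"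
    unfolding primitive0_def by (rule someI_ex)
  show "primitive0 f 0 = 0" "(primitive0 f has_real_derivative f x) (at x)"
    using * by auto
qed

lemma primitive0_minus:
  assumes "continuous_on UNIV f" "\<And>x. f (- x) = f x"
  shows "primitive0 f (- x) = - primitive0 f x"
proof -
  have "((\<lambda>x. primitive0 f (- x) + primitive0 f x) has_real_derivative 0) (at x)" for x
    using DERIV_add[OF DERIV_chain2[OF primitive0_deriv[OF assms(1), of "- x"] DERIV_minus[OF DERIV_ident]]
        primitive0_deriv[OF assms(1), of x]] assms(2) by simp
  then have "primitive0 f (- x) + primitive0 f x = primitive0 f (- 0) + primitive0 f 0"
    using DERIV_isconst_all[of "\<lambda>x. primitive0 f (- x) + primitive0 f x" x "- 0"] by simp
  then show ?thesis
    by (simp add: primitive0_0[OF assms(1)])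
qed

text \<open>The primitive of an even function is odd. This is the mechanism that removes the jumps:
  a sign times a function of |x| becomes a function differentiable at 0.\<close>

lemma primitive0_sgn:
  assumes "continuous_on UNIV f" "\<And>x. f (- x) = f x"
  shows "sgn x * primitive0 f \<bar>x\<bar> = primitive0 f x"
  using primitive0_minus[OF assms(1), of x] assms(2) primitive0_0[OF assms(1)]
  by (simp add: sgn_if abs_if)

abbreviation gauss :: "real \<Rightarrow> real" where "gauss \<equiv> \<lambda>s. exp (- s\<^sup>2)"

text \<open>The Beta density after t = 1/(1 + s^2): t^(k - 3/2) (1 - t)^(-1/2) dt = -2 (1 +
  s^2)^(-k) ds.\<close>

abbreviation cauchy :: "nat \<Rightarrow> real \<Rightarrow> real" where "cauchy k \<equiv> \<lambda>s. inverse ((1 + s\<^sup>2) ^ k)"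

lemma one_plus_square_neq_0 [simp]: "1 + x\<^sup>2 \<noteq> (0::real)"
  using zero_le_power2[of x] by linarith

lemma continuous_gauss: "continuous_on UNIV gauss"
  by (intro continuous_intros)

lemma continuous_cauchy: "continuous_on UNIV (cauchy k)"
  by (intro continuous_intros) auto

lemma inc_Gamma_integrable:
  "(\<lambda>t::real. t powr (1/2 - 1) * exp (- t)) integrable_on {0..}" (is ?th1)
  "integral {0..} (\<lambda>t. t powr (1/2 - 1) * exp (- t)) = sqrt pi" (is ?th2)
proof -
  have "((\<lambda>t. t powr (1/2 - 1) * exp (- t)) has_integral sqrt pi) {0..}"
    using Gamma_integral_real[of "1/2"] by (simp add: exp_minus field_simps Gamma_one_half_real)
  then show ?th1 ?th2 by (auto simp: has_integral_iff)
qed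

text \<open>With t = s^2 one has t^(-1/2) dt = 2 ds, so the integral over [0, w] is twice the
  Gaussian primitive at sqrt w; the rest is the complement in \<Gamma>(1/2) = sqrt \<pi>.\<close>

lemma inc_Gamma_half:
  assumes "w \<ge> 0"
  shows "inc_Gamma (1/2) w = sqrt pi - 2 * primitive0 gauss (sqrt w)"
proof -
  let ?f = "\<lambda>t::real. t powr (1/2 - 1) * exp (- t)"
  let ?G = "primitive0 gauss"
  have contG: "continuous_on S ?G" for S
    by (rule DERIV_continuous_on[where D = gauss])
       (rule has_field_derivative_at_within, rule primitive0_deriv[OF continuous_gauss])
  \<comment> \<open>The square root is not differentiable at 0, so the fundamental theorem is
    applied with continuity at the endpoint and derivatives in the interior only.\<close>
  have I: "(?f has_integral (2 * ?G (sqrt w) - 2 * ?G (sqrt 0))) {0..w}"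
  proof (rule fundamental_theorem_of_calculus_interior)
    show "continuous_on {0..w} (\<lambda>t. 2 * ?G (sqrt t))"
      by (intro continuous_intros continuous_on_compose2[OF contG[of UNIV]]) auto
    fix t assume t: "t \<in> {0<..<w}"
    then have "((\<lambda>t. 2 * ?G (sqrt t)) has_real_derivative (2 * (gauss (sqrt t) * (inverse (sqrt t) / 2)))) (at t)"
      by (intro DERIV_cmult DERIV_chain2[OF primitive0_deriv[OF continuous_gauss]] DERIV_real_sqrt) auto
    moreover have "2 * (gauss (sqrt t) * (inverse (sqrt t) / 2)) = ?f t"
      using t by (simp add: powr_minus powr_half_sqrt)
    ultimately show "((\<lambda>t. 2 * ?G (sqrt t)) has_vector_derivative ?f t) (at t)"
      by (simp add: has_real_derivative_iff_has_vector_derivative)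
  qed (use assms in auto)
  \<comment> \<open>Gauge integrability does not pass to arbitrary measurable subsets; nonnegativity
    upgrades it to absolute integrability, which does.\<close>
  have int_w: "?f integrable_on {w..}"
  proof (cases "w = 0")
    case False
    have "?f integrable_on ({0..} - {0..w})"
    proof -
      have "?f absolutely_integrable_on {0..}"
        using inc_Gamma_integrable(1) by (rule nonnegative_absolutely_integrable_1) auto
      moreover have "{0..} - {0..w} \<in> sets lebesgue" by auto
      ultimately have "?f absolutely_integrable_on ({0..} - {0..w})"
        by (rule set_integrable_subset) auto
      then show ?thesis using set_lebesgue_integral_eq_integral(1) by blast
    qed
    moreover have "{0..} - {0..w} = {w<..}" using assms by auto
    ultimately have "?f integrable_on {w<..}" by simp
    then show ?thesis
    proof (rule integrable_spike_set)
      show "negligible {t \<in> {w<..} - {w..}. ?f t \<noteq> 0}"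
        by (rule negligible_subset[of "{}"]) auto
      show "negligible {t \<in> {w..} - {w<..}. ?f t \<noteq> 0}"
        by (rule negligible_subset[of "{w}"]) auto
    qed
  qed (use inc_Gamma_integrable in simp)
  have U: "(?f has_integral (integral {0..w} ?f + integral {w..} ?f)) ({0..w} \<union> {w..})"
  proof (rule has_integral_Un)
    show "(?f has_integral integral {0..w} ?f) {0..w}" using I by (auto simp: has_integral_iff)
    show "(?f has_integral integral {w..} ?f) {w..}" using int_w by auto
    show "negligible ({0..w} \<inter> {w..})" by (rule negligible_subset[of "{w}"]) auto
  qed
  have "{0..w} \<union> {w..} = {0..}" using assms by auto
  then have "sqrt pi = integral {0..w} ?f + integral {w..} ?f"
    using integral_unique[OF U] inc_Gamma_integrable(2) by (simp only:)
  moreover have "integral {0..w} ?f = 2 * ?G (sqrt w)"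
    using integral_unique[OF I] primitive0_0[OF continuous_gauss] by (simp only: real_sqrt_zero)
  ultimately show ?thesis
    unfolding inc_Gamma_def by linarith
qed

lemma inc_Gamma_half_nonneg: "inc_Gamma (1/2) w \<ge> 0"
proof (cases "(\<lambda>t::real. t powr (1/2 - 1) * exp (- t)) integrable_on {w..}")
  case True
  show ?thesis
    unfolding inc_Gamma_def by (rule integral_nonneg[OF True]) simp
next
  \<comment> \<open>\<open>integral\<close> has the default value 0 on non-integrable functions,
    which satisfies the bound.\<close>
  case False
  show ?thesis
    unfolding inc_Gamma_def not_integrable_integral[OF False] by simp
qed

text \<open>For w \<le> 1 the full value sqrt \<pi> is a bound and exp 1 * exp (- w) is at least 1;
  for w > 1 the factor t^(-1/2) is at most 1 and a pure exponential remains. The constant covers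
  both ranges.\<close>

lemma inc_Gamma_half_le:
  assumes "w \<ge> 0"
  shows "inc_Gamma (1/2) w \<le> sqrt pi * exp 1 * exp (- w)"
proof (cases "w \<le> 1")
  case True
  have "primitive0 gauss 0 \<le> primitive0 gauss (sqrt w)"
  proof (rule DERIV_nonneg_imp_nondecreasing[where f = "primitive0 gauss"])
    show "\<exists>y. (primitive0 gauss has_real_derivative y) (at x) \<and> 0 \<le> y" for x
      using primitive0_deriv[OF continuous_gauss] by (intro exI[of _ "gauss x"]) auto
  qed (use assms in auto)
  then have "inc_Gamma (1/2) w \<le> sqrt pi * 1"
    using inc_Gamma_half[OF assms] primitive0_0[OF continuous_gauss] by simp
  also have "\<dots> \<le> sqrt pi * (exp 1 * exp (- w))"
    using True by (intro mult_left_mono) (auto simp flip: exp_add)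
  finally show ?thesis by (simp add: mult.assoc)
next
  case False
  have I: "((\<lambda>t. exp (- t)) has_integral exp (- w)) {w..}"
    using has_integral_exp_minus_to_infinity[of 1 w] by simp
  have "inc_Gamma (1/2) w \<le> exp (- w)"
  proof (cases "(\<lambda>t::real. t powr (1/2 - 1) * exp (- t)) integrable_on {w..}")
    case True
    have "inc_Gamma (1/2) w \<le> integral {w..} (\<lambda>t. exp (- t))"
      unfolding inc_Gamma_def
    proof (rule integral_le[OF True has_integral_integrable[OF I]])
      fix t assume "t \<in> {w..}"
      then have "t powr (1/2 - 1) \<le> 1"
        using False powr_mono[of "1/2 - 1" 0 t] by simp
      then show "t powr (1/2 - 1) * exp (- t) \<le> exp (- t)"
        by (simp add: mult_le_cancel_right1)
    qed
    also have "\<dots> = exp (- w)"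
      by (rule integral_unique[OF I])
    finally show ?thesis .
  next
    case False
    show ?thesis
      unfolding inc_Gamma_def not_integrable_integral[OF False] by simp
  qed
  moreover have "1 * exp (- w) \<le> (sqrt pi * exp 1) * exp (- w)"
  proof (rule mult_right_mono)
    have "1 * 1 \<le> sqrt pi * exp 1"
      using pi_gt3 by (intro mult_mono) auto
    then show "1 \<le> sqrt pi * exp 1" by simp
  qed auto
  ultimately show ?thesis by linarith
qed

section \<open>The Beta integral with parameters k - 1/2 and 1/2\<close>

abbreviation beta_dens :: "nat \<Rightarrow> real \<Rightarrow> real" where
  "beta_dens k \<equiv> \<lambda>t. t powr (real k - 1/2 - 1) * (1 - t) powr (1/2 - 1)"

abbreviation beta_half :: "nat \<Rightarrow> real" where
  "beta_half k \<equiv> beta_fun (real k - 1/2) (1/2)"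

lemma
  assumes "k \<ge> 1"
  shows beta_half_pos: "beta_half k > 0"
    and beta_dens_integrable: "beta_dens k integrable_on {0..1}"
proof -
  have pos: "real k - 1/2 > 0"
    using assms by linarith
  have I: "(beta_dens k has_integral Beta (real k - 1/2) (1/2)) {0..1}"
    by (rule has_integral_Beta_real) (use pos in auto)
  then show "beta_dens k integrable_on {0..1}"
    by (rule has_integral_integrable)
  have "Beta (real k - 1/2) (1/2) > 0"
    unfolding Beta_def using pos by (intro divide_pos_pos mult_pos_pos Gamma_real_pos) auto
  then show "beta_half k > 0"
    using integral_unique[OF I] by (simp only: beta_fun_def inc_beta_def)
qed

lemma inc_beta_half_split:
  assumes "k \<ge> 1" "0 \<le> w" "w \<le> 1"
  shows "inc_beta w (real k - 1/2) (1/2) + integral {w..1} (beta_dens k) = beta_half k"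
  unfolding beta_fun_def inc_beta_def
  by (rule Henstock_Kurzweil_Integration.integral_combine[OF assms(2,3) beta_dens_integrable[OF assms(1)]])

text \<open>The order k - 1/2 at w = 0 is the source of all decay of the Beta part. For w \<le> 1/2
  the factor (1 - t)^(-1/2) is at most 2 and a power is integrated; for w > 1/2 the trivial bound by
  the complete integral suffices, since 2^k w^(k - 1/2) \<ge> 1. The constant adds the two
  cases.\<close>

lemma psi_bounds:
  assumes "k \<ge> 1" "0 < w" "w \<le> 1"
  shows "0 \<le> psi k w" "psi k w \<le> (2 + beta_half k * 2 ^ k) * w powr (real k - 1/2)"
proof -
  have int: "beta_dens k integrable_on {0..w}" "beta_dens k integrable_on {w..1}"
    by (rule integrable_on_subinterval[OF beta_dens_integrable[OF assms(1)]]; use assms in simp)+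
  have nn: "0 \<le> inc_beta w (real k - 1/2) (1/2)"
    unfolding inc_beta_def by (rule integral_nonneg[OF int(1)]) simp
  then show "0 \<le> psi k w" by (simp add: psi_def)
  have "0 \<le> integral {w..1} (beta_dens k)"
    by (rule integral_nonneg[OF int(2)]) simp
  then have le: "inc_beta w (real k - 1/2) (1/2) \<le> beta_half k"
    using inc_beta_half_split[of k w] assms by linarith
  have pos: "beta_half k > 0" by (rule beta_half_pos[OF assms(1)])
  show "psi k w \<le> (2 + beta_half k * 2 ^ k) * w powr (real k - 1/2)"
  proof (cases "w \<le> 1/2")
    case True
    have P: "((\<lambda>t. t powr (real k - 1/2 - 1)) has_integral
        (w powr (real k - 1/2 - 1 + 1) / (real k - 1/2 - 1 + 1))) {0..w}"
      by (rule has_integral_powr_from_0) (use assms in auto)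
    have "inc_beta w (real k - 1/2) (1/2) \<le>
        2 * (w powr (real k - 1/2 - 1 + 1) / (real k - 1/2 - 1 + 1))"
      unfolding inc_beta_def
    proof (rule has_integral_le[OF integrable_integral[OF int(1)] has_integral_mult_right[OF P]])
      fix t assume t: "t \<in> {0..w}"
      have "(1 - t) powr (1/2 - 1) \<le> (1/2) powr (1/2 - 1)"
        by (rule powr_mono2') (use t True in auto)
      also have "\<dots> \<le> (1/2) powr (- 1)"
        by (rule powr_mono') auto
      finally show "beta_dens k t \<le> 2 * t powr (real k - 1/2 - 1)"
        using mult_left_mono[of "(1 - t) powr (1/2 - 1)" 2 "t powr (real k - 1/2 - 1)"]
        by (simp add: powr_minus mult.commute)
    qed
    also have "\<dots> \<le> 4 * w powr (real k - 1/2)"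
    proof -
      have "w powr (real k - 1/2) / (real k - 1/2) \<le> w powr (real k - 1/2) / (1/2)"
        by (rule divide_left_mono) (use assms in auto)
      then show ?thesis by simp
    qed
    finally have "psi k w \<le> 2 * w powr (real k - 1/2)"
      by (simp add: psi_def)
    also have "\<dots> \<le> (2 + beta_half k * 2 ^ k) * w powr (real k - 1/2)"
      using pos by (intro mult_right_mono) auto
    finally show ?thesis .
  next
    case False
    have "1 = (2::real) ^ k * (1/2) powr real k"
      by (simp add: powr_realpow flip: power_mult_distrib)
    also have "\<dots> \<le> 2 ^ k * w powr (real k - 1/2)"
      using False assms powr_mono2[of "real k" "1/2" w] powr_mono'[of "real k - 1/2" "real k" w]
      by (intro mult_left_mono) auto
    finally have "beta_half k * 1 \<le> beta_half k * (2 ^ k * w powr (real k - 1/2))"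
      using pos by (intro mult_left_mono) auto
    moreover have "psi k w \<le> beta_half k"
      using le nn by (simp add: psi_def)
    moreover have "0 \<le> 2 * w powr (real k - 1/2)" by simp
    ultimately show ?thesis by (simp only: distrib_right mult.assoc)
  qed
qed

text \<open>Under t = 1/(1 + s^2) the complementary range from w to 1 becomes the range of s from
  sqrt (1/w - 1) down to 0.\<close>

lemma psi_eq:
  assumes "k \<ge> 1" "0 < w" "w \<le> 1"
  shows "psi k w = beta_half k / 2 - primitive0 (cauchy k) (sqrt (1 / w - 1))"
proof -
  let ?K = "primitive0 (cauchy k)"
  have contK: "continuous_on UNIV ?K"
    by (rule DERIV_continuous_on[where D = "cauchy k"])
       (rule has_field_derivative_at_within, rule primitive0_deriv[OF continuous_cauchy])
  \<comment> \<open>At t = 1 the density is singular and sqrt (1/t - 1) is not differentiable, so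
    again only interior derivatives are used.\<close>
  have I: "(beta_dens k has_integral
      ((- 2 * ?K (sqrt (1 / 1 - 1))) - (- 2 * ?K (sqrt (1 / w - 1))))) {w..1}"
  proof (rule fundamental_theorem_of_calculus_interior[where f = "\<lambda>t. - 2 * ?K (sqrt (1 / t - 1))"])
    show "continuous_on {w..1} (\<lambda>t. - 2 * ?K (sqrt (1 / t - 1)))"
      by (intro continuous_intros continuous_on_compose2[OF contK]) (use assms in auto)
    fix t assume t: "t \<in> {w<..<1}"
    then have t01: "0 < t" "t < 1" using assms by auto
    have r: "1 / t - 1 > 0" using t01 by (simp add: field_simps)
    have d1: "((\<lambda>t. 1 / t - 1) has_real_derivative (- 1 / t\<^sup>2)) (at t)"
      using t01 by (auto intro!: derivative_eq_intros simp: power2_eq_square field_simps)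
    have "((\<lambda>t. sqrt (1 / t - 1)) has_real_derivative
        (inverse (sqrt (1 / t - 1)) / 2 * (- 1 / t\<^sup>2))) (at t)"
      by (rule DERIV_chain2[OF DERIV_real_sqrt[OF r] d1])
    then have "((\<lambda>t. - 2 * ?K (sqrt (1 / t - 1))) has_real_derivative
       (- 2 * (cauchy k (sqrt (1 / t - 1)) * (inverse (sqrt (1 / t - 1)) / 2 * (- 1 / t\<^sup>2))))) (at t)"
      by (intro DERIV_cmult DERIV_chain2[OF primitive0_deriv[OF continuous_cauchy]])
    moreover have "- 2 * (cauchy k (sqrt (1 / t - 1)) * (inverse (sqrt (1 / t - 1)) / 2 * (- 1 / t\<^sup>2)))
        = beta_dens k t"
    proof -
      have "cauchy k (sqrt (1 / t - 1)) = t ^ k"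
        using r t01 by (simp add: power_one_over)
      moreover have "sqrt (1 / t - 1) = sqrt (1 - t) / sqrt t"
        using t01 by (simp add: real_sqrt_divide[symmetric] diff_divide_distrib)
      moreover have "t powr (real k - 1/2 - 1) = t ^ k * sqrt t / t\<^sup>2"
      proof -
        have "t powr (real k - 1/2 - 1) = t powr (real k + 1/2 - 2)" by simp
        also have "\<dots> = t powr real k * t powr (1/2) / t powr 2"
          by (simp only: powr_diff powr_add)
        finally show ?thesis using t01 by (simp add: powr_realpow powr_half_sqrt)
      qed
      moreover have "(1 - t) powr (1/2 - 1) = inverse (sqrt (1 - t))"
        using t01 by (simp add: powr_minus powr_half_sqrt)
      ultimately have "?thesis \<longleftrightarrow> - 2 * (t ^ k * (inverse (sqrt (1 - t) / sqrt t) / 2 * (- 1 / t\<^sup>2)))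
          = t ^ k * sqrt t / t\<^sup>2 * inverse (sqrt (1 - t))"
        by (simp only:)
      moreover have "- 2 * (T * (inverse (u / s) / 2 * (- 1 / p))) = T * s / p * inverse u"
        for T u s p :: real
        by (simp only: divide_inverse inverse_mult_distrib inverse_inverse_eq mult_minus_left
            mult_minus_right minus_minus mult_1_left) simp
      ultimately show ?thesis by blast
    qed
    ultimately show "((\<lambda>t. - 2 * ?K (sqrt (1 / t - 1))) has_vector_derivative beta_dens k t) (at t)"
      by (simp add: has_real_derivative_iff_has_vector_derivative)
  qed (use assms in auto)
  have "integral {w..1} (beta_dens k) = 2 * ?K (sqrt (1 / w - 1))"
    using integral_unique[OF I] primitive0_0[OF continuous_cauchy] by simp
  then show ?thesis
    using inc_beta_half_split[of k w] assms unfolding psi_def by simp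
qed

section \<open>Termwise differentiation and sums over integral forms\<close>

text \<open>Unconditional sums are approximated along finite index sets, so the argument is a
  three-part estimate: a finite sum is differentiated directly, and the increments and the
  derivatives of the remaining terms are both controlled by the tail of M. Convexity of S serves the
  mean value inequality.\<close>

lemma has_derivative_infsum:
  fixes f :: "'i \<Rightarrow> 'a::real_normed_vector \<Rightarrow> 'b::banach" and M :: "'i \<Rightarrow> real"
  assumes S: "open S" "convex S" "x \<in> S"
    and f': "\<And>i y. i \<in> A \<Longrightarrow> y \<in> S \<Longrightarrow> (f i has_derivative f' i y) (at y)"
    and bound: "\<And>i y h. i \<in> A \<Longrightarrow> y \<in> S \<Longrightarrow> norm (f' i y h) \<le> M i * norm h"
    and M: "M summable_on A" "\<And>i. i \<in> A \<Longrightarrow> 0 \<le> M i"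
    and summ: "\<And>y. y \<in> S \<Longrightarrow> (\<lambda>i. f i y) summable_on A"
  shows "(\<lambda>i. f' i x h) summable_on A"
    and "((\<lambda>y. \<Sum>\<^sub>\<infinity>i\<in>A. f i y) has_derivative (\<lambda>h. \<Sum>\<^sub>\<infinity>i\<in>A. f' i x h)) (at x)"
proof -
  have Mh: "(\<lambda>i. M i * c) summable_on B" if "B \<subseteq> A" for B c
    using summable_on_subset[OF M(1) that] by (rule summable_on_cmult_left)
  have f'_sum: "(\<lambda>i. f' i x h) summable_on B" if "B \<subseteq> A" for h B
    by (rule abs_summable_summable, rule Infinite_Sum.abs_summable_on_comparison_test'[OF Mh[OF that, of "norm h"]])
       (use bound S that in auto)
  then show "(\<lambda>i. f' i x h) summable_on A" by simp
  have f'_norm: "norm (\<Sum>\<^sub>\<infinity>i\<in>B. f' i x h) \<le> infsum M B * norm h" if "B \<subseteq> A" for B h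
  proof -
    have "norm (\<Sum>\<^sub>\<infinity>i\<in>B. f' i x h) \<le> (\<Sum>\<^sub>\<infinity>i\<in>B. M i * norm h)"
      by (rule norm_infsum_le[OF has_sum_infsum has_sum_infsum])
         (use bound S that f'_sum[OF that] Mh[OF that] in auto)
    also have "\<dots> = infsum M B * norm h" by (rule infsum_cmult_left')
    finally show ?thesis .
  qed
  have lin: "linear (f' i x)" if "i \<in> A" for i
    using f'[OF that S(3)] has_derivative_linear by blast
  let ?D = "\<lambda>h. \<Sum>\<^sub>\<infinity>i\<in>A. f' i x h"
  have "bounded_linear ?D"
  proof (rule bounded_linear_intro[where K = "infsum M A"])
    show "?D (u + v) = ?D u + ?D v" for u v
    proof -
      have "?D (u + v) = (\<Sum>\<^sub>\<infinity>i\<in>A. f' i x u + f' i x v)"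
        by (rule infsum_cong) (simp add: linear_add[OF lin])
      also have "\<dots> = ?D u + ?D v" by (rule infsum_add) (auto intro: f'_sum)
      finally show ?thesis .
    qed
    show "?D (c *\<^sub>R u) = c *\<^sub>R ?D u" for c u
    proof -
      have "?D (c *\<^sub>R u) = (\<Sum>\<^sub>\<infinity>i\<in>A. c *\<^sub>R f' i x u)"
        by (rule infsum_cong) (simp add: linear_scale[OF lin])
      then show ?thesis by (simp add: infsum_scaleR_right)
    qed
    show "norm (?D u) \<le> norm u * infsum M A" for u
      using f'_norm[of A u] by (simp add: mult.commute)
  qed
  moreover have "\<exists>d>0. \<forall>y. norm (y - x) < d \<longrightarrow>
      norm ((\<Sum>\<^sub>\<infinity>i\<in>A. f i y) - (\<Sum>\<^sub>\<infinity>i\<in>A. f i x) - ?D (y - x)) \<le> e * norm (y - x)"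
    if e: "e > 0" for e
  proof -
    \<comment> \<open>One third of e for each of: the finite part, the increments of the tail, the
      derivative of the tail.\<close>
    obtain F where F: "finite F" "F \<subseteq> A" "dist (sum M F) (infsum M A) \<le> e / 3"
      using infsum_finite_approximation[OF M(1), of "e / 3"] e by auto
    define R where "R = A - F"
    have R: "R \<subseteq> A" "A = F \<union> R" "F \<inter> R = {}" using F by (auto simp: R_def)
    have split: "infsum g A = sum g F + infsum g R" if "g summable_on A" for g :: "'i \<Rightarrow> 'c::banach"
      using infsum_Un_disjoint[of g F R] summable_on_subset_banach[OF that, of R] R F by simp
    have MR: "infsum M R \<le> e / 3"
      using split[OF M(1)] F(3) by (simp add: dist_real_def)
    have "((\<lambda>y. \<Sum>i\<in>F. f i y) has_derivative (\<lambda>h. \<Sum>i\<in>F. f' i x h)) (at x)"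
      by (rule has_derivative_sum) (use f' F S in auto)
    then obtain d1 where d1: "d1 > 0" "\<And>y. norm (y - x) < d1 \<Longrightarrow>
       norm ((\<Sum>i\<in>F. f i y) - (\<Sum>i\<in>F. f i x) - (\<Sum>i\<in>F. f' i x (y - x))) \<le> e / 3 * norm (y - x)"
      unfolding has_derivative_at_alt using e by (metis divide_pos_pos zero_less_numeral)
    obtain d2 where d2: "d2 > 0" "ball x d2 \<subseteq> S"
      using S open_contains_ball by blast
    have "norm ((\<Sum>\<^sub>\<infinity>i\<in>A. f i y) - (\<Sum>\<^sub>\<infinity>i\<in>A. f i x) - ?D (y - x)) \<le> e * norm (y - x)"
      if y: "norm (y - x) < min d1 d2" for y
    proof -
      have yS: "y \<in> S" using y d2 by (auto simp: dist_norm norm_minus_commute)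
      have fR: "(\<lambda>i. f i u) summable_on R" if "u \<in> S" for u
        using summable_on_subset_banach[OF summ[OF that] R(1)] .
      have diffR: "norm ((\<Sum>\<^sub>\<infinity>i\<in>R. f i y) - (\<Sum>\<^sub>\<infinity>i\<in>R. f i x)) \<le> e / 3 * norm (y - x)"
      proof -
        have "((\<lambda>i. f i y - f i x) has_sum ((\<Sum>\<^sub>\<infinity>i\<in>R. f i y) - (\<Sum>\<^sub>\<infinity>i\<in>R. f i x))) R"
          using has_sum_add[OF has_sum_infsum[OF fR[OF yS]] has_sum_bounded_linear[OF bounded_linear_minus[OF bounded_linear_ident] has_sum_infsum[OF fR[OF S(3)]]]]
          by simp
        then have "norm ((\<Sum>\<^sub>\<infinity>i\<in>R. f i y) - (\<Sum>\<^sub>\<infinity>i\<in>R. f i x)) \<le> (\<Sum>\<^sub>\<infinity>i\<in>R. M i * norm (y - x))"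
        proof (rule norm_infsum_le[OF _ has_sum_infsum])
          fix i assume i: "i \<in> R"
          \<comment> \<open>The mean value inequality on S bounds each increment by M i uniformly,
            so one choice of F works for all y near x.\<close>
          show "norm (f i y - f i x) \<le> M i * norm (y - x)"
          proof (rule differentiable_bound[OF S(2), where f = "f i" and f' = "f' i"])
            fix u assume u: "u \<in> S"
            have iA: "i \<in> A" using i R(1) by blast
            show "(f i has_derivative f' i u) (at u within S)"
              by (rule has_derivative_at_withinI[OF f'[OF iA u]])
            show "onorm (f' i u) \<le> M i"
              by (rule onorm_bound[OF M(2)[OF iA] bound[OF iA u]])
          qed (rule yS, rule S(3))
        qed (rule Mh[OF R(1)])
        also have "\<dots> = infsum M R * norm (y - x)" by (rule infsum_cmult_left')
        also have "\<dots> \<le> e / 3 * norm (y - x)" using MR by (rule mult_right_mono) simp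
        finally show ?thesis .
      qed
      have derR: "norm (\<Sum>\<^sub>\<infinity>i\<in>R. f' i x (y - x)) \<le> e / 3 * norm (y - x)"
        using f'_norm[OF R(1), of "y - x"] mult_right_mono[OF MR, of "norm (y - x)"] by simp
      have "(\<Sum>\<^sub>\<infinity>i\<in>A. f i y) - (\<Sum>\<^sub>\<infinity>i\<in>A. f i x) - ?D (y - x)
        = ((\<Sum>i\<in>F. f i y) - (\<Sum>i\<in>F. f i x) - (\<Sum>i\<in>F. f' i x (y - x)))
          + ((\<Sum>\<^sub>\<infinity>i\<in>R. f i y) - (\<Sum>\<^sub>\<infinity>i\<in>R. f i x)) - (\<Sum>\<^sub>\<infinity>i\<in>R. f' i x (y - x))"
        using split[OF summ[OF yS]] split[OF summ[OF S(3)]] split[OF f'_sum[OF subset_refl], of "y - x"]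
        by simp
      also have "norm \<dots> \<le> e / 3 * norm (y - x) + e / 3 * norm (y - x) + e / 3 * norm (y - x)"
        by (intro norm_triangle_le_diff add_mono norm_triangle_le d1 diffR derR) (use y in auto)
      finally show ?thesis by (simp add: field_simps)
    qed
    then show ?thesis using d1(1) d2(1) by (intro exI[of _ "min d1 d2"]) auto
  qed
  ultimately show "((\<lambda>y. \<Sum>\<^sub>\<infinity>i\<in>A. f i y) has_derivative ?D) (at x)"
    unfolding has_derivative_at_alt by blast
qed

section \<open>Summation over the rank three lattice of integral forms\<close>

definition height :: "qform \<Rightarrow> real" where
  "height Q = (case Q of (a, b, c) \<Rightarrow> 1 + \<bar>of_int a\<bar> + \<bar>of_int b\<bar> + \<bar>of_int c\<bar>)"

lemma height_ge_1: "height Q \<ge> 1"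
  by (auto simp: height_def split: prod.splits)

lemma height_pos: "height Q > 0"
  using height_ge_1[of Q] by linarith

definition disc :: "qform \<Rightarrow> int" where
  "disc Q = (case Q of (a, b, c) \<Rightarrow> b\<^sup>2 - 4 * a * c)"

lemma mem_forms_of_disc [simp]: "Q \<in> forms_of_disc D \<longleftrightarrow> disc Q = D"
  by (auto simp: forms_of_disc_def disc_def)

lemma summable_on_int_powr:
  fixes s :: real
  assumes "s < - 1"
  shows "(\<lambda>n::int. (1 + \<bar>of_int n\<bar>) powr s) summable_on UNIV"
proof -
  let ?f = "\<lambda>n::int. (1 + \<bar>of_int n\<bar>) powr s"
  have "summable (\<lambda>n. real n powr s)"
    using assms by (simp add: summable_real_powr_iff)
  then have "summable (\<lambda>n. real (Suc n) powr s)"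
    by (subst summable_Suc_iff)
  then have N: "(\<lambda>n. (1 + real n) powr s) summable_on UNIV"
    by (intro summable_nonneg_imp_summable_on) auto
  have "?f summable_on range int"
    using N by (subst summable_on_reindex) (auto simp: o_def)
  moreover have "?f summable_on range (\<lambda>n. - int n)"
    using N by (subst summable_on_reindex) (auto simp: o_def inj_on_def)
  moreover have "range int \<union> range (\<lambda>n. - int n) = UNIV"
    by (auto simp: image_iff) (metis int_cases2)
  ultimately show ?thesis
    using summable_on_union by metis
qed

lemma summable_on_Times_real:
  fixes f :: "'a \<Rightarrow> real" and g :: "'b \<Rightarrow> real"
  assumes "f summable_on A" "g summable_on B" "\<And>x. f x \<ge> 0" "\<And>y. g y \<ge> 0"
  shows "(\<lambda>(x, y). f x * g y) summable_on A \<times> B"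
proof (rule summable_on_SigmaI)
  show "((\<lambda>y. case (x, y) of (x, y) \<Rightarrow> f x * g y) has_sum f x * infsum g B) B" for x
    using has_sum_cmult_right[OF has_sum_infsum[OF assms(2)], of "f x"] by simp
  show "(\<lambda>x. f x * infsum g B) summable_on A"
    by (rule summable_on_cmult_left[OF assms(1)])
qed (use assms in auto)

text \<open>The height dominates each of 1 + |a|, 1 + |b|, 1 + |c|, so its power s is at most the
  product of their powers s/3. Each factor is summable over the integers exactly when s/3 <
  -1.\<close>

lemma summable_on_height:
  fixes s :: real
  assumes "s < - 3"
  shows "(\<lambda>Q. height Q powr s) summable_on A"
proof -
  let ?w = "\<lambda>n::int. (1 + \<bar>of_int n\<bar>) powr (s / 3)"
  have W: "?w summable_on UNIV" using assms by (intro summable_on_int_powr) auto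
  have "(\<lambda>(a, bc). ?w a * (case bc of (b, c) \<Rightarrow> ?w b * ?w c)) summable_on UNIV \<times> (UNIV \<times> UNIV)"
    by (intro summable_on_Times_real W) (auto split: prod.splits)
  then have "(\<lambda>(a, bc). ?w a * (case bc of (b, c) \<Rightarrow> ?w b * ?w c)) summable_on UNIV" by simp
  then have "(\<lambda>Q. height Q powr s) summable_on UNIV"
  proof (rule summable_on_comparison_test)
    fix Q :: qform
    obtain a b c where Q: "Q = (a, b, c)" by (cases Q)
    have le: "height Q powr (s / 3) \<le> ?w n" if "n \<in> {a, b, c}" for n
      using that assms by (intro powr_mono2') (auto simp: Q height_def)
    have "height Q powr s = height Q powr (s / 3) * (height Q powr (s / 3) * height Q powr (s / 3))"
      by (simp flip: powr_add)
    also have "\<dots> \<le> ?w a * (?w b * ?w c)"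
      by (intro mult_mono le) auto
    finally show "height Q powr s \<le> (case Q of (a, bc) \<Rightarrow> ?w a * (case bc of (b, c) \<Rightarrow> ?w b * ?w c))"
      by (simp add: Q)
  qed auto
  then show ?thesis by (rule summable_on_subset) auto
qed

text \<open>Forms are partitioned by discriminant, and summability of the merged family licenses the
  regrouping. The summand \<open>f\<close> takes D separately because the double series are written
  with D, whereas \<open>g\<close> sees only the form.\<close>

lemma infsum_by_disc:
  fixes g :: "qform \<Rightarrow> 'a::banach"
  assumes "g summable_on {Q. disc Q \<in> I}"
    and "\<And>Q. disc Q \<in> I \<Longrightarrow> f (disc Q) Q = g Q"
  shows "(\<Sum>\<^sub>\<infinity>D\<in>I. \<Sum>\<^sub>\<infinity>Q\<in>forms_of_disc D. f D Q) = infsum g {Q. disc Q \<in> I}"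
proof -
  have "(\<Sum>\<^sub>\<infinity>D\<in>I. \<Sum>\<^sub>\<infinity>Q\<in>forms_of_disc D. f D Q) = (\<Sum>\<^sub>\<infinity>D\<in>I. \<Sum>\<^sub>\<infinity>Q\<in>forms_of_disc D. g (snd (D, Q)))"
    using assms(2) by (auto intro!: infsum_cong)
  also have "\<dots> = infsum (\<lambda>p. g (snd p)) (Sigma I forms_of_disc)"
  proof (rule infsum_Sigma_banach)
    show "(\<lambda>p. g (snd p)) summable_on Sigma I forms_of_disc"
      using assms(1)
      by (subst summable_on_reindex_bij_witness[where i = "\<lambda>Q. (disc Q, Q)" and j = snd
            and T = "{Q. disc Q \<in> I}" and h = g]) auto
  qed
  also have "\<dots> = infsum g {Q. disc Q \<in> I}"
    by (rule infsum_reindex_bij_witness[where i = "\<lambda>Q. (disc Q, Q)" and j = snd]) auto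
  finally show ?thesis .
qed

section \<open>Quadratic forms on the upper half-plane\<close>

definition qder :: "qform \<Rightarrow> complex \<Rightarrow> complex" where
  "qder Q \<tau> = (case Q of (a, b, c) \<Rightarrow> 2 * of_int a * \<tau> + of_int b)"

lemma qeval_has_field_derivative: "(qeval Q has_field_derivative qder Q \<tau>) (at \<tau>)"
proof -
  obtain a b c where Q: "Q = (a, b, c)" by (cases Q)
  have "qeval Q = (\<lambda>\<tau>. of_int a * \<tau>\<^sup>2 + of_int b * \<tau> + of_int c)"
    by (simp add: Q qeval_def fun_eq_iff)
  then show ?thesis
    by (auto intro!: derivative_eq_intros simp: Q qder_def)
qed

lemma Re_qeval: "Re (qeval (a, b, c) \<tau>) = of_int a * ((Re \<tau>)\<^sup>2 - (Im \<tau>)\<^sup>2) + of_int b * Re \<tau> + of_int c"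
  and Im_qeval: "Im (qeval (a, b, c) \<tau>) = (2 * of_int a * Re \<tau> + of_int b) * Im \<tau>"
  by (simp_all add: qeval_def power2_eq_square algebra_simps)

lemma qtau_altdef:
  "qtau (a, b, c) \<tau> = (of_int a * ((Re \<tau>)\<^sup>2 + (Im \<tau>)\<^sup>2) + of_int b * Re \<tau> + of_int c) / Im \<tau>"
  by (simp add: qtau_def cmod_power2)

text \<open>Evaluated at h = 1 and h = \<i>, this real-linear map gives Im Q / y^2 and - Re Q / y^2,
  hence the conjugate derivative (Im Q - \<i> Re Q) / (2 y^2) = - \<i> Q / (2 y^2), where Q is
  \<open>qeval Q \<tau>\<close>.\<close>

lemma qtau_has_derivative:
  assumes "Im \<tau> > 0"
  shows "(qtau Q has_derivative (\<lambda>h. Im (qeval Q \<tau> * cnj h) / (Im \<tau>)\<^sup>2)) (at \<tau>)"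
proof -
  obtain a b c where Q: "Q = (a, b, c)" by (cases Q)
  have *: "qtau Q = (\<lambda>\<tau>. (of_int a * ((Re \<tau>)\<^sup>2 + (Im \<tau>)\<^sup>2) + of_int b * Re \<tau> + of_int c) / Im \<tau>)"
    by (simp add: Q qtau_altdef fun_eq_iff)
  show ?thesis
    unfolding * using assms
    by (auto intro!: derivative_eq_intros ext
        simp: Q Re_qeval Im_qeval power2_eq_square field_simps)
qed

lemma cmod_qeval_square:
  assumes "Im \<tau> > 0"
  shows "(cmod (qeval Q \<tau>))\<^sup>2 = (Im \<tau>)\<^sup>2 * (of_int (disc Q) + (qtau Q \<tau>)\<^sup>2)"
proof -
  obtain a b c where Q: "Q = (a, b, c)" by (cases Q)
  have "(Im \<tau>)\<^sup>2 * (qtau Q \<tau>)\<^sup>2 = (of_int a * ((Re \<tau>)\<^sup>2 + (Im \<tau>)\<^sup>2) + of_int b * Re \<tau> + of_int c)\<^sup>2"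
    using assms by (simp add: Q qtau_altdef power_divide)
  then show ?thesis
    unfolding distrib_left
    by (simp add: cmod_power2 Q Re_qeval Im_qeval disc_def) (simp add: power2_eq_square algebra_simps)
qed

lemma qeval_nonzero:
  assumes "Im \<tau> > 0" "disc Q > 0"
  shows "qeval Q \<tau> \<noteq> 0"
proof
  assume "qeval Q \<tau> = 0"
  then have "of_int (disc Q) + (qtau Q \<tau>)\<^sup>2 = 0"
    using cmod_qeval_square[OF assms(1), of Q] assms(1) by simp
  then show False
    using assms(2) zero_le_power2[of "qtau Q \<tau>"] by (smt (verit) of_int_0_less_iff)
qed

text \<open>Replacing b by -b permutes the forms of a given discriminant. It thus turns the value of
  \<open>Omega\<close> at \<open>- cnj \<tau>\<close> into a series in conjugates of
  \<open>qeval Q \<tau>\<close>.\<close>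

lemma qeval_neg_cnj: "qeval (a, - b, c) (- cnj \<tau>) = cnj (qeval (a, b, c) \<tau>)"
  by (simp add: qeval_def)

lemma disc_le_height: "\<bar>of_int (disc Q)\<bar> \<le> 5 * (height Q)\<^sup>2"
proof -
  obtain a b c where Q: "Q = (a, b, c)" by (cases Q)
  have le: "\<bar>of_int a\<bar> \<le> height Q" "\<bar>of_int b\<bar> \<le> height Q" "\<bar>of_int c\<bar> \<le> height Q"
    by (auto simp: Q height_def)
  have "\<bar>real_of_int (disc Q)\<bar> \<le> \<bar>of_int b\<bar> * \<bar>of_int b\<bar> + 4 * (\<bar>of_int a\<bar> * \<bar>of_int c\<bar>)"
    using abs_triangle_ineq4[of "(of_int b)\<^sup>2 :: real" "4 * of_int a * of_int c"]
    by (simp add: Q disc_def abs_mult power2_eq_square mult.assoc)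
  also have "\<dots> \<le> height Q * height Q + 4 * (height Q * height Q)"
    by (intro add_mono mult_mono le order_refl) (use height_pos[of Q] in auto)
  finally show ?thesis by (simp add: power2_eq_square)
qed

lemma cmod_qeval_le:
  assumes "cmod \<tau> \<le> R"
  shows "cmod (qeval Q \<tau>) \<le> (1 + R)\<^sup>2 * height Q"
    and "cmod (qder Q \<tau>) \<le> 2 * (1 + R)\<^sup>2 * height Q"
    and "\<bar>qtau Q \<tau>\<bar> * \<bar>Im \<tau>\<bar> \<le> (1 + R)\<^sup>2 * height Q"
proof -
  obtain a b c where Q: "Q = (a, b, c)" by (cases Q)
  have R: "R \<ge> 0" using assms norm_ge_zero order_trans by blast
  have RR: "R \<le> (1 + R)\<^sup>2" "1 \<le> (1 + R)\<^sup>2" "R\<^sup>2 \<le> (1 + R)\<^sup>2"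
    using R by (auto simp: power2_eq_square algebra_simps)
  have t2: "(cmod \<tau>)\<^sup>2 \<le> (1 + R)\<^sup>2" using assms R by (intro power_mono) auto
  have sum: "\<bar>of_int a\<bar> * (1 + R)\<^sup>2 + \<bar>of_int b\<bar> * (1 + R)\<^sup>2 + \<bar>of_int c\<bar> * (1 + R)\<^sup>2 \<le> (1 + R)\<^sup>2 * height Q"
    by (simp add: Q height_def algebra_simps)
  have "cmod (qeval Q \<tau>) \<le> \<bar>of_int a\<bar> * (cmod \<tau>)\<^sup>2 + \<bar>of_int b\<bar> * cmod \<tau> + \<bar>of_int c\<bar> * 1"
    unfolding Q qeval_def prod.case
    by (intro norm_triangle_le add_mono) (simp_all add: norm_mult norm_power)
  also have "\<dots> \<le> \<bar>of_int a\<bar> * (1 + R)\<^sup>2 + \<bar>of_int b\<bar> * (1 + R)\<^sup>2 + \<bar>of_int c\<bar> * (1 + R)\<^sup>2"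
    by (intro add_mono mult_left_mono order_trans[OF assms] RR t2) auto
  finally show "cmod (qeval Q \<tau>) \<le> (1 + R)\<^sup>2 * height Q" using sum by simp
  have "cmod (qder Q \<tau>) \<le> 2 * (\<bar>of_int a\<bar> * cmod \<tau>) + \<bar>of_int b\<bar> * 1"
    unfolding Q qder_def prod.case
    by (intro norm_triangle_le add_mono) (simp_all add: norm_mult)
  also have "\<dots> \<le> 2 * (\<bar>of_int a\<bar> * (1 + R)\<^sup>2) + \<bar>of_int b\<bar> * (1 + R)\<^sup>2"
    by (intro add_mono mult_left_mono order_trans[OF assms] RR t2) auto
  also have "\<dots> \<le> 2 * (1 + R)\<^sup>2 * height Q"
    by (simp add: Q height_def algebra_simps)
  finally show "cmod (qder Q \<tau>) \<le> 2 * (1 + R)\<^sup>2 * height Q" .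
  have "\<bar>qtau Q \<tau>\<bar> * \<bar>Im \<tau>\<bar> \<le> \<bar>of_int a * (cmod \<tau>)\<^sup>2 + of_int b * Re \<tau> + of_int c\<bar>"
    by (cases "Im \<tau> = 0") (simp_all add: Q qtau_def abs_divide)
  also have "\<dots> \<le> \<bar>of_int a\<bar> * (cmod \<tau>)\<^sup>2 + \<bar>of_int b\<bar> * \<bar>Re \<tau>\<bar> + \<bar>of_int c\<bar> * 1"
    by (intro order_trans[OF abs_triangle_ineq] add_mono) (simp_all add: abs_mult)
  also have "\<dots> \<le> \<bar>of_int a\<bar> * (1 + R)\<^sup>2 + \<bar>of_int b\<bar> * (1 + R)\<^sup>2 + \<bar>of_int c\<bar> * (1 + R)\<^sup>2"
    by (intro add_mono mult_left_mono order_trans[OF abs_Re_le_cmod] order_trans[OF assms] RR t2) auto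
  finally show "\<bar>qtau Q \<tau>\<bar> * \<bar>Im \<tau>\<bar> \<le> (1 + R)\<^sup>2 * height Q" using sum by simp
qed

text \<open>The right-hand side is the positive definite form \<open>|Q(\<tau>,1)|\<^sup>2 / y\<^sup>2 + Q\<^sub>\<tau>\<^sup>2\<close>.\<close>

lemma height_le_majorant:
  assumes y: "0 < y" "y \<le> Im \<tau>" and R: "cmod \<tau> \<le> R" and "Q \<noteq> (0, 0, 0)"
  shows "(height Q)\<^sup>2 \<le> 8 * ((1 + R)\<^sup>2 * (1 + 2 / y))\<^sup>2 * (of_int (disc Q) + 2 * (qtau Q \<tau>)\<^sup>2)"
proof -
  obtain a b c where Q: "Q = (a, b, c)" by (cases Q)
  define q where "q = qtau Q \<tau>"
  \<comment> \<open>Up to a factor, m is the square root of the majorant. Each coefficient is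
    recovered linearly from \<open>qeval\<close> and \<open>qtau\<close>, and hence is bounded by a
    multiple of m.\<close>
  define m where "m = cmod (qeval Q \<tau>) / Im \<tau> + \<bar>q\<bar>"
  have t: "0 < Im \<tau>" "Im \<tau> \<le> R" "\<bar>Re \<tau>\<bar> \<le> R"
    using y R abs_Re_le_cmod[of \<tau>] abs_Im_le_cmod[of \<tau>] by linarith+
  then have R0: "R \<ge> 0" by linarith
  have m0: "m \<ge> 0" using t by (simp add: m_def)
  have qt: "q * Im \<tau> = of_int a * ((Re \<tau>)\<^sup>2 + (Im \<tau>)\<^sup>2) + of_int b * Re \<tau> + of_int c"
    using t by (simp add: q_def Q qtau_altdef)
  have mt: "m * Im \<tau> = cmod (qeval Q \<tau>) + \<bar>q\<bar> * Im \<tau>"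
    using t by (simp add: m_def field_simps)
  \<comment> \<open>The real part of \<open>qeval\<close> and \<open>q * Im \<tau>\<close> differ
    only in the sign of the a y^2 term, which isolates a. The imaginary part then gives b, and the
    formula for q gives c.\<close>
  have "2 * of_int a * (Im \<tau>)\<^sup>2 = q * Im \<tau> - Re (qeval Q \<tau>)"
    unfolding qt Q Re_qeval by (simp add: algebra_simps)
  then have "\<bar>2 * of_int a * (Im \<tau>)\<^sup>2\<bar> \<le> \<bar>q * Im \<tau>\<bar> + \<bar>Re (qeval Q \<tau>)\<bar>"
    by simp
  also have "\<dots> \<le> m * Im \<tau>"
    using abs_Re_le_cmod[of "qeval Q \<tau>"] t by (simp add: mt abs_mult)
  finally have "(2 * \<bar>of_int a\<bar> * Im \<tau>) * Im \<tau> \<le> m * Im \<tau>"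
    by (simp add: abs_mult power2_eq_square mult.assoc)
  then have "2 * \<bar>of_int a\<bar> * Im \<tau> \<le> m"
    using t by simp
  moreover have "2 * \<bar>of_int a\<bar> * y \<le> 2 * \<bar>of_int a\<bar> * Im \<tau>"
    using y by (intro mult_left_mono) auto
  ultimately have "2 * \<bar>of_int a\<bar> * y \<le> m" by linarith
  then have a: "\<bar>of_int a\<bar> \<le> m / y / 2"
    using y by (simp add: field_simps)
  have "\<bar>2 * of_int a * Re \<tau> + of_int b\<bar> * Im \<tau> = \<bar>Im (qeval Q \<tau>)\<bar>"
    using t by (simp add: Q Im_qeval abs_mult)
  also have "\<dots> \<le> m * Im \<tau>"
    unfolding mt using abs_Im_le_cmod[of "qeval Q \<tau>"] t by (intro add_increasing2) auto
  finally have "\<bar>2 * of_int a * Re \<tau> + of_int b\<bar> \<le> m"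
    using t by simp
  then have "\<bar>of_int b\<bar> \<le> m + \<bar>2 * of_int a * Re \<tau>\<bar>" by linarith
  also have "\<dots> = m + 2 * (\<bar>of_int a\<bar> * \<bar>Re \<tau>\<bar>)" by (simp add: abs_mult)
  also have "\<dots> \<le> m + 2 * (m / y / 2 * R)"
    using a t m0 y by (intro add_left_mono mult_left_mono mult_mono) auto
  finally have b: "\<bar>of_int b\<bar> \<le> m + m / y * R" by simp
  have "of_int c = q * Im \<tau> - of_int a * (cmod \<tau>)\<^sup>2 - of_int b * Re \<tau>"
    unfolding qt cmod_power2 by simp
  then have "\<bar>of_int c :: real\<bar> \<le> \<bar>q * Im \<tau>\<bar> + \<bar>of_int a * (cmod \<tau>)\<^sup>2\<bar> + \<bar>of_int b * Re \<tau>\<bar>"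
    by linarith
  also have "\<dots> = \<bar>q\<bar> * Im \<tau> + \<bar>of_int a\<bar> * (cmod \<tau>)\<^sup>2 + \<bar>of_int b\<bar> * \<bar>Re \<tau>\<bar>"
    using t by (simp add: abs_mult)
  also have "\<dots> \<le> m * R + m / y / 2 * R\<^sup>2 + (m + m / y * R) * R"
    using a b t m0 y R by (intro add_mono mult_mono power_mono) (auto simp: m_def)
  finally have c: "\<bar>of_int c\<bar> \<le> m * R + m / y / 2 * R\<^sup>2 + (m + m / y * R) * R" .
  \<comment> \<open>Integrality enters here: a non-zero form has coefficient sum at least 1, which
    absorbs the summand 1 of the height.\<close>
  have "\<bar>a\<bar> + \<bar>b\<bar> + \<bar>c\<bar> \<ge> 1" using assms(4) Q by auto
  then have "\<bar>of_int a\<bar> + \<bar>of_int b\<bar> + \<bar>of_int c\<bar> \<ge> (1::real)" by linarith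
  then have "height Q \<le> 2 * (\<bar>of_int a\<bar> + \<bar>of_int b\<bar> + \<bar>of_int c\<bar>)"
    by (simp add: Q height_def)
  also have "\<dots> \<le> 2 * (m / y / 2 + (m + m / y * R) + (m * R + m / y / 2 * R\<^sup>2 + (m + m / y * R) * R))"
    by (intro mult_left_mono add_mono a b c) simp
  also have "\<dots> = 2 * (m * (1 + 2 * R) + m / y * (1 / 2 + R + 3 / 2 * R\<^sup>2))"
    by (simp add: algebra_simps power2_eq_square)
  also have "\<dots> \<le> 2 * (m * (1 + R)\<^sup>2 + m / y * (2 * (1 + R)\<^sup>2))"
  proof (intro mult_left_mono add_mono)
    show "1 + 2 * R \<le> (1 + R)\<^sup>2" by (simp add: power2_eq_square algebra_simps)
    have "0 \<le> R\<^sup>2" by simp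
    then show "1 / 2 + R + 3 / 2 * R\<^sup>2 \<le> 2 * (1 + R)\<^sup>2"
      using R0 by (simp add: power2_sum field_simps)
  qed (use m0 y in auto)
  also have "\<dots> = 2 * ((1 + R)\<^sup>2 * (1 + 2 / y)) * m"
    by (simp add: algebra_simps)
  finally have "(height Q)\<^sup>2 \<le> (2 * ((1 + R)\<^sup>2 * (1 + 2 / y)) * m)\<^sup>2"
    using height_pos[of Q] by (intro power_mono) auto
  also have "\<dots> = 4 * ((1 + R)\<^sup>2 * (1 + 2 / y))\<^sup>2 * m\<^sup>2"
    by (simp add: power_mult_distrib)
  \<comment> \<open>The squared factor 2 gives 4, and (u + v)^2 \<le> 2 u^2 + 2 v^2 doubles it to
    the constant 8.\<close>
  also have "\<dots> \<le> 4 * ((1 + R)\<^sup>2 * (1 + 2 / y))\<^sup>2 * (2 * (of_int (disc Q) + 2 * q\<^sup>2))"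
  proof (rule mult_left_mono)
    have "m\<^sup>2 \<le> 2 * (cmod (qeval Q \<tau>) / Im \<tau>)\<^sup>2 + 2 * \<bar>q\<bar>\<^sup>2"
      unfolding m_def using zero_le_power2[of "cmod (qeval Q \<tau>) / Im \<tau> - \<bar>q\<bar>"]
      by (simp only: power2_sum power2_diff)
    also have "(cmod (qeval Q \<tau>) / Im \<tau>)\<^sup>2 = of_int (disc Q) + q\<^sup>2"
      using cmod_qeval_square[OF t(1), of Q] t by (simp add: power_divide q_def)
    finally show "m\<^sup>2 \<le> 2 * (of_int (disc Q) + 2 * q\<^sup>2)" by simp
  qed simp
  also have "4 * K * (2 * X) = 8 * K * X" for K X :: real by simp
  finally show ?thesis by (simp only: q_def)
qed

section \<open>The real factor of the series\<close>

text \<open>This is the sum of \<open>psi_part\<close> (for \<open>D > 0\<close>) and \<open>gamma_part\<close> below, rewritten so that no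
  jump at \<open>q = 0\<close> remains when \<open>D > 0\<close>. For \<open>D \<le> 0\<close> the jump stays, but then \<open>q = 0\<close> occurs only for
  the zero form.\<close>

definition pfun :: "nat \<Rightarrow> int \<Rightarrow> real \<Rightarrow> real \<Rightarrow> real" where
  "pfun k D q v = 2 / sqrt pi * primitive0 gauss (2 * sqrt (pi * v) * q) -
     (if D > 0 then 2 / beta_half k * primitive0 (cauchy k) (q / sqrt (of_int D)) else sgn q)"

text \<open>Together with \<open>gamma_part\<close> this is the factor as it stands in the defining
  series, with D y^2 / |Q(\<tau>,1)|^2 rewritten as D / (D + q^2). Bounds are proved for these two,
  derivatives for \<open>pfun\<close>.\<close>

definition psi_part :: "nat \<Rightarrow> int \<Rightarrow> real \<Rightarrow> real" where
  "psi_part k D q = 2 / beta_half k * (sgn q * psi k (of_int D / (of_int D + q\<^sup>2)))"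

definition gamma_part :: "real \<Rightarrow> real \<Rightarrow> real" where
  "gamma_part q v = - (1 / sqrt pi * (sgn q * inc_Gamma (1/2) (4 * pi * q\<^sup>2 * v)))"

lemma gauss_even: "gauss (- x) = gauss x" for x :: real
  by simp

lemma cauchy_even: "cauchy k (- x) = cauchy k x" for x :: real
  by simp

lemma gamma_part_eq:
  assumes "v \<ge> 0"
  shows "gamma_part q v = 2 / sqrt pi * primitive0 gauss (2 * sqrt (pi * v) * q) - sgn q"
proof -
  let ?r = "2 * sqrt (pi * v)"
  have r: "?r \<ge> 0" using assms by simp
  have "sqrt (4 * pi * q\<^sup>2 * v) = \<bar>?r * q\<bar>"
    using assms by (simp add: real_sqrt_mult abs_mult)
  then have "inc_Gamma (1/2) (4 * pi * q\<^sup>2 * v) = sqrt pi - 2 * primitive0 gauss \<bar>?r * q\<bar>"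
    using inc_Gamma_half[of "4 * pi * q\<^sup>2 * v"] assms by simp
  moreover have "sgn q * primitive0 gauss \<bar>?r * q\<bar> = primitive0 gauss (?r * q)"
  \<comment> \<open>For v = 0 the sign of the rescaled argument is lost, but both sides are then
    0.\<close>
  proof (cases "?r = 0")
    case True
    then have "?r * q = 0" by simp
    then show ?thesis by (simp only: abs_zero primitive0_0[OF continuous_gauss] mult_zero_right)
  next
    case False
    then have "?r > 0" using r by linarith
    then have "sgn (?r * q) = sgn q" by (simp add: sgn_mult)
    then show ?thesis
      using primitive0_sgn[OF continuous_gauss gauss_even, of "?r * q"] by (simp only:)
  qed
  ultimately show ?thesis
    by (simp add: gamma_part_def right_diff_distrib)
qed

lemma psi_part_eq:
  assumes "k \<ge> 1" "D > 0"
  shows "psi_part k D q = sgn q - 2 / beta_half k * primitive0 (cauchy k) (q / sqrt (of_int D))"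
proof -
  let ?D = "real_of_int D"
  have D: "?D > 0" using assms by simp
  have Dq: "?D + q\<^sup>2 > 0" using D by (intro add_pos_nonneg) auto
  \<comment> \<open>For w = D / (D + q^2) the endpoint sqrt (1/w - 1) is |q| / sqrt D, which
    explains the argument of the Beta primitive in \<open>pfun\<close>.\<close>
  have "1 / (?D / (?D + q\<^sup>2)) - 1 = q\<^sup>2 / ?D"
    using D Dq by (simp add: field_simps)
  then have "sqrt (1 / (?D / (?D + q\<^sup>2)) - 1) = \<bar>q / sqrt ?D\<bar>"
    using D by (simp add: real_sqrt_divide)
  then have "psi k (?D / (?D + q\<^sup>2)) = beta_half k / 2 - primitive0 (cauchy k) \<bar>q / sqrt ?D\<bar>"
    using psi_eq[of k "?D / (?D + q\<^sup>2)"] D Dq assms(1) by simp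
  moreover have "sgn (q / sqrt ?D) = sgn q"
    using D by (simp add: sgn_divide)
  then have "sgn q * primitive0 (cauchy k) \<bar>q / sqrt ?D\<bar> = primitive0 (cauchy k) (q / sqrt ?D)"
    using primitive0_sgn[OF continuous_cauchy cauchy_even, of "q / sqrt ?D"] by (simp only:)
  ultimately show ?thesis
    unfolding psi_part_def using beta_half_pos[OF assms(1)] by (simp add: right_diff_distrib)
qed

text \<open>The normalisations 2 / \<beta> and 1 / sqrt \<pi> make the jump terms exactly
  \<open>sgn q\<close> and \<open>- sgn q\<close>, so they cancel for D > 0.\<close>

lemma pfun_eq:
  assumes "k \<ge> 1" "v \<ge> 0"
  shows "pfun k D q v = (if D > 0 then psi_part k D q else 0) + gamma_part q v"
  using gamma_part_eq[OF assms(2), of q] psi_part_eq[OF assms(1), of D q]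
  by (simp add: pfun_def)

text \<open>The Gaussian summand will produce \<open>Theta_star\<close>; the rational one, present
  for D > 0 only, will produce \<open>Omega\<close>.\<close>

definition pfun_q :: "nat \<Rightarrow> int \<Rightarrow> real \<Rightarrow> real \<Rightarrow> real" where
  "pfun_q k D q v = 4 * sqrt v * exp (- 4 * pi * q\<^sup>2 * v) -
     (if D > 0 then 2 / beta_half k * (of_int D powr (real k - 1/2) / (of_int D + q\<^sup>2) ^ k) else 0)"

definition pfun_v :: "real \<Rightarrow> real \<Rightarrow> real" where
  "pfun_v q v = 2 * q / sqrt v * exp (- 4 * pi * q\<^sup>2 * v)"

lemma gauss_arg: "v \<ge> 0 \<Longrightarrow> gauss (2 * sqrt (pi * v) * q) = exp (- 4 * pi * q\<^sup>2 * v)"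
  by (simp add: power_mult_distrib algebra_simps)

lemma DERIV_sgn:
  fixes q :: real
  assumes "q \<noteq> 0"
  shows "(sgn has_real_derivative 0) (at q)"
proof (rule has_field_derivative_transform_within_open[where f = "\<lambda>_. sgn q" and S = "if q > 0 then {0<..} else {..<0}"])
  show "((\<lambda>_. sgn q) has_real_derivative 0) (at q)" by simp
qed (use assms in \<open>auto split: if_splits\<close>)

text \<open>The last hypothesis keeps q away from the one remaining jump: for D \<le> 0 the sign is
  still part of \<open>pfun\<close>.\<close>

lemma pfun_deriv_q:
  assumes "k \<ge> 1" "v \<ge> 0" "D > 0 \<or> q \<noteq> 0"
  shows "((\<lambda>q. pfun k D q v) has_real_derivative pfun_q k D q v) (at q)"
proof -
  let ?r = "2 * sqrt (pi * v)"
  have "((\<lambda>q. ?r * q) has_real_derivative ?r) (at q)"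
    using DERIV_cmult_Id by blast
  then have "((\<lambda>q. primitive0 gauss (?r * q)) has_real_derivative (gauss (?r * q) * ?r)) (at q)"
    by (rule DERIV_chain2[OF primitive0_deriv[OF continuous_gauss]])
  then have "((\<lambda>q. 2 / sqrt pi * primitive0 gauss (?r * q)) has_real_derivative
      (2 / sqrt pi * (gauss (?r * q) * ?r))) (at q)"
    by (rule DERIV_cmult)
  moreover have "2 / sqrt pi * (gauss (?r * q) * ?r) = 4 * sqrt v * exp (- 4 * pi * q\<^sup>2 * v)"
    unfolding gauss_arg[OF assms(2)] by (simp add: real_sqrt_mult)
  ultimately have G: "((\<lambda>q. 2 / sqrt pi * primitive0 gauss (?r * q)) has_real_derivative
      (4 * sqrt v * exp (- 4 * pi * q\<^sup>2 * v))) (at q)" by simp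
  show ?thesis
  proof (cases "D > 0")
    case True
    let ?D = "real_of_int D"
    have D: "?D > 0" using True by simp
    have "((\<lambda>q. q / sqrt ?D) has_real_derivative (1 / sqrt ?D)) (at q)"
      by (rule DERIV_cdivide[OF DERIV_ident])
    then have "((\<lambda>q. primitive0 (cauchy k) (q / sqrt ?D)) has_real_derivative
        (cauchy k (q / sqrt ?D) * (1 / sqrt ?D))) (at q)"
      by (rule DERIV_chain2[OF primitive0_deriv[OF continuous_cauchy]])
    then have "((\<lambda>q. 2 / beta_half k * primitive0 (cauchy k) (q / sqrt ?D)) has_real_derivative
        (2 / beta_half k * (cauchy k (q / sqrt ?D) * (1 / sqrt ?D)))) (at q)"
      by (rule DERIV_cmult)
    \<comment> \<open>Clearing D from 1 + q^2 / D gives D^k, and the inner derivative gives 1 / sqrt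
      D: this is the origin of the weight D^(k - 1/2) in the series f_D.\<close>
    moreover have "cauchy k (q / sqrt ?D) * (1 / sqrt ?D) = ?D powr (real k - 1/2) / (?D + q\<^sup>2) ^ k"
    proof -
      have "1 + (q / sqrt ?D)\<^sup>2 = (?D + q\<^sup>2) / ?D"
        using D by (simp add: power_divide field_simps)
      then have "cauchy k (q / sqrt ?D) = ?D ^ k / (?D + q\<^sup>2) ^ k"
        by (simp add: power_divide)
      moreover have "?D powr (real k - 1/2) = ?D ^ k / sqrt ?D"
        using D by (simp add: powr_diff powr_realpow powr_half_sqrt)
      ultimately show ?thesis by simp
    qed
    ultimately have "((\<lambda>q. 2 / beta_half k * primitive0 (cauchy k) (q / sqrt ?D)) has_real_derivative
        (2 / beta_half k * (?D powr (real k - 1/2) / (?D + q\<^sup>2) ^ k))) (at q)"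
      by (simp only:)
    from DERIV_diff[OF G this] show ?thesis
      using True by (simp add: pfun_def pfun_q_def)
  next
    case False
    then have "(sgn has_real_derivative 0) (at q)" using assms by (intro DERIV_sgn) auto
    from DERIV_diff[OF G this] show ?thesis
      using False by (simp add: pfun_def pfun_q_def)
  qed
qed

text \<open>With q fixed, the sign and the Beta primitive are constants, so only the error function
  contributes and no condition on q arises.\<close>

lemma pfun_deriv_v:
  assumes "v > 0"
  shows "((\<lambda>v. pfun k D q v) has_real_derivative pfun_v q v) (at v)"
proof -
  let ?r = "\<lambda>v. 2 * sqrt (pi * v) * q"
  have r: "(?r has_real_derivative (2 * (inverse (sqrt (pi * v)) / 2 * pi) * q)) (at v)"
    by (intro DERIV_cmult DERIV_cmult_right DERIV_chain2[OF DERIV_real_sqrt] DERIV_cmult_Id)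
       (use assms in auto)
  then have "((\<lambda>v. primitive0 gauss (?r v)) has_real_derivative
      (gauss (?r v) * (2 * (inverse (sqrt (pi * v)) / 2 * pi) * q))) (at v)"
    by (rule DERIV_chain2[OF primitive0_deriv[OF continuous_gauss]])
  then have "((\<lambda>v. 2 / sqrt pi * primitive0 gauss (?r v)) has_real_derivative
      (2 / sqrt pi * (gauss (?r v) * (2 * (inverse (sqrt (pi * v)) / 2 * pi) * q)))) (at v)"
    by (rule DERIV_cmult)
  moreover have "2 / sqrt pi * (gauss (?r v) * (2 * (inverse (sqrt (pi * v)) / 2 * pi) * q)) = pfun_v q v"
  proof -
    have "pi / sqrt pi = sqrt pi" by (simp add: real_div_sqrt)
    then have "2 / sqrt pi * (e * (2 * (inverse (sqrt (pi * v)) / 2 * pi) * q)) = 2 * q / sqrt v * e" for e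
      using assms by (simp add: real_sqrt_mult field_simps)
    then show ?thesis
      using assms unfolding pfun_v_def by (simp only: gauss_arg)
  qed
  ultimately have "((\<lambda>v. 2 / sqrt pi * primitive0 gauss (?r v)) has_real_derivative pfun_v q v) (at v)"
    by simp
  then show ?thesis
    unfolding pfun_def by (rule DERIV_diff[OF _ DERIV_const, simplified])
qed

section \<open>Uniform bounds\<close>

text \<open>Raise x/j \<le> exp (x/j) to the power j.\<close>

lemma power_le_exp:
  fixes x :: real
  assumes "x \<ge> 0"
  shows "x ^ j \<le> real j ^ j * exp x"
proof (cases "j = 0")
  case False
  have "x / real j \<le> exp (x / real j)"
    using exp_ge_add_one_self[of "x / real j"] by linarith
  then have "(x / real j) ^ j \<le> exp (x / real j) ^ j"
    using assms by (intro power_mono) auto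
  also have "\<dots> = exp x" using False by (simp flip: exp_of_nat_mult)
  finally show ?thesis using False by (simp add: power_divide field_simps)
qed (use assms in simp)

lemma cmod_qexp: "cmod (qexp D z) = exp (- 2 * pi * of_int D * Im z)"
  by (simp add: qexp_def)

lemma height_powr [simp]:
  "height Q powr 0 = 1" "height Q powr 1 = height Q" "height Q powr 2 = (height Q)\<^sup>2"
  "height Q \<noteq> 0" "\<bar>height Q\<bar> = height Q"
  using height_pos[of Q] by (auto simp: powr_numeral)

section \<open>Orders of decay, uniform on a region in both variables\<close>

locale region =
  fixes y R v V :: real
  assumes y_pos: "0 < y" and v_pos: "0 < v"
begin

text \<open>The real part of z is unrestricted because the modulus of \<open>qexp\<close> depends on
  \<open>Im z\<close> only.\<close>

definition reg :: "qform \<Rightarrow> complex \<Rightarrow> complex \<Rightarrow> bool" where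
  "reg Q \<tau> z \<longleftrightarrow> Q \<noteq> (0, 0, 0) \<and> y \<le> Im \<tau> \<and> cmod \<tau> \<le> R \<and> v \<le> Im z \<and> Im z \<le> V"

text \<open>An O-notation with constant independent of form and point. Orders add under products, so
  the later estimates reduce to counting exponents.\<close>

definition decay :: "real \<Rightarrow> (qform \<Rightarrow> complex \<Rightarrow> complex \<Rightarrow> 'a::real_normed_vector) \<Rightarrow> bool" where
  "decay s f \<longleftrightarrow> (\<exists>C\<ge>0. \<forall>Q \<tau> z. reg Q \<tau> z \<longrightarrow> norm (f Q \<tau> z) \<le> C * height Q powr s)"

lemma decayI:
  assumes "\<And>Q \<tau> z. reg Q \<tau> z \<Longrightarrow> norm (f Q \<tau> z) \<le> C * height Q powr s"
  shows "decay s f"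
  unfolding decay_def
proof (intro exI[of _ "max C 0"] conjI allI impI)
  fix Q \<tau> z assume r: "reg Q \<tau> z"
  have "C * height Q powr s \<le> max C 0 * height Q powr s" by (intro mult_right_mono) auto
  then show "norm (f Q \<tau> z) \<le> max C 0 * height Q powr s" using assms[OF r] by linarith
qed simp

lemma decayE:
  assumes "decay s f"
  obtains C where "C \<ge> 0" "\<And>Q \<tau> z. reg Q \<tau> z \<Longrightarrow> norm (f Q \<tau> z) \<le> C * height Q powr s"
  using assms unfolding decay_def by blast

lemma decay_dom:
  assumes "decay s g" "\<And>Q \<tau> z. reg Q \<tau> z \<Longrightarrow> norm (f Q \<tau> z) \<le> c * norm (g Q \<tau> z)"
  shows "decay s f"
proof -
  obtain C where C: "C \<ge> 0" "\<And>Q \<tau> z. reg Q \<tau> z \<Longrightarrow> norm (g Q \<tau> z) \<le> C * height Q powr s"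
    using assms(1) by (rule decayE) blast
  show ?thesis
  proof (rule decayI)
    fix Q \<tau> z assume r: "reg Q \<tau> z"
    have "norm (f Q \<tau> z) \<le> \<bar>c\<bar> * norm (g Q \<tau> z)"
      using assms(2)[OF r] mult_right_mono[OF abs_ge_self, of "norm (g Q \<tau> z)" c] by simp
    also have "\<dots> \<le> \<bar>c\<bar> * (C * height Q powr s)" by (intro mult_left_mono C r) auto
    finally show "norm (f Q \<tau> z) \<le> (\<bar>c\<bar> * C) * height Q powr s" by (simp add: mult.assoc)
  qed
qed

lemma decay_cong:
  assumes "decay s g" "\<And>Q \<tau> z. reg Q \<tau> z \<Longrightarrow> norm (f Q \<tau> z) = norm (g Q \<tau> z)"
  shows "decay s f"
  by (rule decay_dom[OF assms(1), of _ 1]) (simp add: assms(2))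

lemma decay_mono:
  assumes "decay s f" "s \<le> t"
  shows "decay t f"
proof -
  obtain C where C: "C \<ge> 0" "\<And>Q \<tau> z. reg Q \<tau> z \<Longrightarrow> norm (f Q \<tau> z) \<le> C * height Q powr s"
    using assms(1) by (rule decayE) blast
  show ?thesis
  proof (rule decayI)
    fix Q \<tau> z assume r: "reg Q \<tau> z"
    have "C * height Q powr s \<le> C * height Q powr t"
      using height_ge_1[of Q] C(1) assms(2) by (intro mult_left_mono powr_mono) auto
    then show "norm (f Q \<tau> z) \<le> C * height Q powr t" using C(2)[OF r] by linarith
  qed
qed

lemma decay_add:
  assumes "decay s f" "decay s g"
  shows "decay s (\<lambda>Q \<tau> z. f Q \<tau> z + g Q \<tau> z)"
proof -
  obtain C where C: "C \<ge> 0" "\<And>Q \<tau> z. reg Q \<tau> z \<Longrightarrow> norm (f Q \<tau> z) \<le> C * height Q powr s"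
    using assms(1) by (rule decayE) blast
  obtain D where D: "D \<ge> 0" "\<And>Q \<tau> z. reg Q \<tau> z \<Longrightarrow> norm (g Q \<tau> z) \<le> D * height Q powr s"
    using assms(2) by (rule decayE) blast
  show ?thesis
  proof (rule decayI)
    fix Q \<tau> z assume r: "reg Q \<tau> z"
    show "norm (f Q \<tau> z + g Q \<tau> z) \<le> (C + D) * height Q powr s"
      using norm_triangle_mono[OF C(2)[OF r] D(2)[OF r]] by (simp add: distrib_right)
  qed
qed

lemma decay_mult:
  fixes f g :: "qform \<Rightarrow> complex \<Rightarrow> complex \<Rightarrow> 'a::real_normed_algebra"
  assumes "decay s f" "decay t g"
  shows "decay (s + t) (\<lambda>Q \<tau> z. f Q \<tau> z * g Q \<tau> z)"
proof -
  obtain C where C: "C \<ge> 0" "\<And>Q \<tau> z. reg Q \<tau> z \<Longrightarrow> norm (f Q \<tau> z) \<le> C * height Q powr s"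
    using assms(1) by (rule decayE) blast
  obtain D where D: "D \<ge> 0" "\<And>Q \<tau> z. reg Q \<tau> z \<Longrightarrow> norm (g Q \<tau> z) \<le> D * height Q powr t"
    using assms(2) by (rule decayE) blast
  show ?thesis
  proof (rule decayI)
    fix Q \<tau> z assume r: "reg Q \<tau> z"
    have "norm (f Q \<tau> z * g Q \<tau> z) \<le> norm (f Q \<tau> z) * norm (g Q \<tau> z)" by (rule norm_mult_ineq)
    also have "\<dots> \<le> (C * height Q powr s) * (D * height Q powr t)"
      by (intro mult_mono C D r) (use C(1) in auto)
    finally show "norm (f Q \<tau> z * g Q \<tau> z) \<le> (C * D) * height Q powr (s + t)"
      by (simp add: powr_add algebra_simps)
  qed
qed

lemma decay_const: "decay 0 (\<lambda>Q \<tau> z. c)"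
  by (rule decayI[where C = "norm c"]) simp

lemma decay_power:
  fixes f :: "qform \<Rightarrow> complex \<Rightarrow> complex \<Rightarrow> 'a::real_normed_algebra_1"
  assumes "decay s f"
  shows "decay (real n * s) (\<lambda>Q \<tau> z. f Q \<tau> z ^ n)"
proof (induction n)
  case 0
  show ?case using decay_const[of 1] by simp
next
  case (Suc n)
  show ?case using decay_mult[OF assms Suc] by (simp add: algebra_simps)
qed

lemma decay_of_real:
  "decay s f \<Longrightarrow> decay s (\<lambda>Q \<tau> z. of_real (f Q \<tau> z) :: 'a::real_normed_algebra_1)"
  by (rule decay_cong) auto

lemma decay_qeval: "decay 1 (\<lambda>Q \<tau> z. qeval Q \<tau>)"
  by (rule decayI[where C = "(1 + R)\<^sup>2"]) (simp add: reg_def cmod_qeval_le(1))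

lemma decay_qder: "decay 1 (\<lambda>Q \<tau> z. qder Q \<tau>)"
  by (rule decayI[where C = "2 * (1 + R)\<^sup>2"]) (simp add: reg_def cmod_qeval_le(2))

lemma decay_qtau: "decay 1 (\<lambda>Q \<tau> z. qtau Q \<tau>)"
proof (rule decayI[where C = "(1 + R)\<^sup>2 / y"])
  fix Q \<tau> z assume r: "reg Q \<tau> z"
  have "\<bar>qtau Q \<tau>\<bar> * y \<le> \<bar>qtau Q \<tau>\<bar> * \<bar>Im \<tau>\<bar>"
    using r y_pos by (intro mult_left_mono) (auto simp: reg_def)
  also have "\<dots> \<le> (1 + R)\<^sup>2 * height Q"
    using r by (intro cmod_qeval_le) (auto simp: reg_def)
  finally show "norm (qtau Q \<tau>) \<le> (1 + R)\<^sup>2 / y * height Q powr 1"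
    using y_pos height_pos[of Q] by (simp add: field_simps)
qed

lemma decay_disc: "decay 2 (\<lambda>Q \<tau> z. of_int (disc Q) :: complex)"
  by (rule decayI[where C = 5]) (simp add: disc_le_height)

text \<open>The reciprocal of the constant in \<open>height_le_majorant\<close>, hence a lower bound
  for the quotient of the positive definite form by the squared height.\<close>

definition floor_const :: real where
  "floor_const = inverse (8 * ((1 + R)\<^sup>2 * (1 + 2 / y))\<^sup>2)"

lemma floor_const_pos:
  assumes "reg Q \<tau> z"
  shows "floor_const > 0"
proof -
  \<comment> \<open>The sign of R is not fixed by the locale; a point of the region forces
    it.\<close>
  have "R \<ge> 0" using assms order_trans[OF norm_ge_zero, of \<tau> R] by (simp add: reg_def)
  then have "(1 + R)\<^sup>2 * (1 + 2 / y) > 0"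
    using y_pos by (intro mult_pos_pos) (auto intro: add_pos_pos)
  then show ?thesis
    unfolding floor_const_def
    by (intro positive_imp_inverse_positive mult_pos_pos[OF _ zero_less_power]) simp_all
qed

lemma floor_const_le:
  assumes "reg Q \<tau> z"
  shows "floor_const * (height Q)\<^sup>2 \<le> of_int (disc Q) + 2 * (qtau Q \<tau>)\<^sup>2"
proof -
  define K where "K = 8 * ((1 + R)\<^sup>2 * (1 + 2 / y))\<^sup>2"
  have K: "K > 0"
    using floor_const_pos[OF assms] unfolding floor_const_def K_def
    by (simp only: inverse_positive_iff_positive)
  have "(height Q)\<^sup>2 \<le> K * (of_int (disc Q) + 2 * (qtau Q \<tau>)\<^sup>2)"
    unfolding K_def by (rule height_le_majorant[OF y_pos]) (use assms in \<open>auto simp: reg_def\<close>)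
  then have "inverse K * (height Q)\<^sup>2 \<le> of_int (disc Q) + 2 * (qtau Q \<tau>)\<^sup>2"
    using K by (simp add: field_simps)
  then show ?thesis unfolding floor_const_def K_def .
qed

text \<open>If both alternatives failed, the positive definite form would be non-positive at a
  non-zero form. This supplies the hypothesis of \<open>pfun_deriv_q\<close> for every term of the
  series.\<close>

lemma qtau_or_disc:
  assumes "reg Q \<tau> z"
  shows "disc Q > 0 \<or> qtau Q \<tau> \<noteq> 0"
proof (rule ccontr)
  assume "\<not> ?thesis"
  then have "of_int (disc Q) + 2 * (qtau Q \<tau>)\<^sup>2 \<le> (0::real)" by simp
  moreover have "0 < floor_const * (height Q)\<^sup>2"
    using floor_const_pos[OF assms] height_pos[of Q] by simp
  ultimately show False using floor_const_le[OF assms] by linarith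
qed

lemma decay_gauss:
  "decay s (\<lambda>Q \<tau> z. of_real (exp (- 4 * pi * (qtau Q \<tau>)\<^sup>2 * Im z)) * qexp (disc Q) z)"
proof -
  obtain n :: nat where n: "- s \<le> real n" using real_arch_simple by blast
  define \<alpha> where "\<alpha> = 2 * pi * v * floor_const"
  have "decay (- real n) (\<lambda>Q \<tau> z. of_real (exp (- 4 * pi * (qtau Q \<tau>)\<^sup>2 * Im z)) * qexp (disc Q) z)"
  proof (rule decayI[where C = "real n ^ n / \<alpha> ^ n"])
    fix Q \<tau> z assume r: "reg Q \<tau> z"
    have \<alpha>: "\<alpha> > 0" using floor_const_pos[OF r] v_pos by (simp add: \<alpha>_def)
    let ?h = "height Q"
    have h: "?h \<ge> 1" by (rule height_ge_1)
    have "0 < floor_const * ?h\<^sup>2" using floor_const_pos[OF r] h by simp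
    then have "v * (floor_const * ?h\<^sup>2) \<le> Im z * (of_int (disc Q) + 2 * (qtau Q \<tau>)\<^sup>2)"
      using r v_pos floor_const_le[OF r] by (intro mult_mono) (auto simp: reg_def)
    then have "2 * pi * (v * (floor_const * ?h\<^sup>2)) \<le> 2 * pi * (Im z * (of_int (disc Q) + 2 * (qtau Q \<tau>)\<^sup>2))"
      by (intro mult_left_mono) auto
    then have le: "\<alpha> * ?h\<^sup>2 \<le> 4 * pi * (qtau Q \<tau>)\<^sup>2 * Im z + 2 * pi * of_int (disc Q) * Im z"
      by (simp add: \<alpha>_def algebra_simps)
    \<comment> \<open>As h \<ge> 1, replacing h^2 by h only weakens the estimate and gives order -n
      directly.\<close>
    have "(\<alpha> * ?h) ^ n \<le> (\<alpha> * ?h\<^sup>2) ^ n"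
      using \<alpha> h by (intro power_mono mult_left_mono) (auto simp: power2_eq_square)
    also have "\<dots> \<le> real n ^ n * exp (\<alpha> * ?h\<^sup>2)"
      using \<alpha> by (intro power_le_exp) auto
    finally have "exp (- (\<alpha> * ?h\<^sup>2)) \<le> real n ^ n / (\<alpha> * ?h) ^ n"
      using \<alpha> h by (simp add: exp_minus field_simps)
    moreover have "norm (of_real (exp (- 4 * pi * (qtau Q \<tau>)\<^sup>2 * Im z)) * qexp (disc Q) z)
        \<le> exp (- (\<alpha> * ?h\<^sup>2))"
      using le by (simp add: norm_mult cmod_qexp flip: exp_add)
    moreover have "real n ^ n / (\<alpha> * ?h) ^ n = real n ^ n / \<alpha> ^ n * ?h powr (- real n)"
      using h by (simp add: power_mult_distrib powr_minus powr_realpow divide_inverse)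
    ultimately show "norm (of_real (exp (- 4 * pi * (qtau Q \<tau>)\<^sup>2 * Im z)) * qexp (disc Q) z)
        \<le> real n ^ n / \<alpha> ^ n * ?h powr (- real n)" by linarith
  qed
  then show ?thesis using n by (elim decay_mono) auto
qed

text \<open>Pays for the powers of D that the Beta estimates leave behind. The restriction to D > 0
  matters, since \<open>qexp\<close> grows as D tends to minus infinity.\<close>

lemma decay_disc_qexp:
  "decay 0 (\<lambda>Q \<tau> z. if disc Q > 0 then of_int (disc Q) ^ n * qexp (disc Q) z else 0)"
proof (rule decayI[where C = "real n ^ n / (2 * pi * v) ^ n"])
  fix Q \<tau> z assume r: "reg Q \<tau> z"
  let ?D = "real_of_int (disc Q)"
  show "norm (if disc Q > 0 then of_int (disc Q) ^ n * qexp (disc Q) z else 0)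
      \<le> real n ^ n / (2 * pi * v) ^ n * height Q powr 0"
  proof (cases "disc Q > 0")
    case True
    have "(2 * pi * v * ?D) ^ n \<le> real n ^ n * exp (2 * pi * v * ?D)"
      using v_pos True by (intro power_le_exp) auto
    then have "?D ^ n * exp (- (2 * pi * v * ?D)) \<le> real n ^ n / (2 * pi * v) ^ n"
      using v_pos by (simp add: power_mult_distrib exp_minus field_simps)
    moreover have "2 * pi * v * ?D \<le> 2 * pi * ?D * Im z"
      using r True by (simp add: reg_def)
    then have "?D ^ n * exp (- (2 * pi * ?D * Im z)) \<le> ?D ^ n * exp (- (2 * pi * v * ?D))"
      using True by (intro mult_left_mono) auto
    ultimately have "?D ^ n * exp (- (2 * pi * ?D * Im z)) \<le> real n ^ n / (2 * pi * v) ^ n"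
      by linarith
    then show ?thesis
      using True by (simp add: norm_mult norm_power cmod_qexp)
  qed (use v_pos in simp)
qed

lemma disc_plus_square_ge:
  assumes "reg Q \<tau> z" "disc Q > 0"
  shows "floor_const / 2 * (height Q)\<^sup>2 \<le> of_int (disc Q) + (qtau Q \<tau>)\<^sup>2"
proof -
  have "0 \<le> real_of_int (disc Q)" using assms(2) by simp
  then show ?thesis using floor_const_le[OF assms(1)] by linarith
qed

lemma powr_minus_half_le:
  fixes x :: real
  assumes "x \<ge> 1"
  shows "x powr (real k - 1/2) \<le> x ^ k"
proof -
  have "x powr (real k - 1/2) \<le> x powr real k"
    using assms by (intro powr_mono) auto
  then show ?thesis using assms by (simp add: powr_realpow)
qed

text \<open>By \<open>psi_bounds\<close> the factor is O(w^(k - 1/2)) with w = O(D / h^2), which is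
  D^(k - 1/2) times the claimed power of h; D^(k - 1/2) \<le> D^k is absorbed by \<open>qexp\<close>
  together with the extra D^n.\<close>

lemma decay_psi_part:
  assumes k: "k \<ge> 1"
  shows "decay (1 - 2 * real k) (\<lambda>Q \<tau> z. if disc Q > 0
     then of_int (disc Q) ^ n * (of_real (psi_part k (disc Q) (qtau Q \<tau>)) * qexp (disc Q) z) else 0)"
proof -
  \<comment> \<open>A is the constant of w = O(D / h^2) raised to k - 1/2; B is the constant of
    \<open>psi_bounds\<close> times the normalisation 2 / \<beta>.\<close>
  define A where "A = (2 / floor_const) powr (real k - 1/2)"
  define B where "B = 2 / beta_half k * (2 + beta_half k * 2 ^ k)"
  have "decay (0 + (1 - 2 * real k)) (\<lambda>Q \<tau> z.
      (if disc Q > 0 then of_int (disc Q) ^ (n + k) * qexp (disc Q) z else 0) *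
      of_real (height Q powr (1 - 2 * real k)))"
    by (rule decay_mult[OF decay_disc_qexp decayI[where C = 1]]) simp
  then show ?thesis
    unfolding add_0
  proof (rule decay_dom[where c = "B * A"])
    fix Q \<tau> z assume r: "reg Q \<tau> z"
    let ?D = "real_of_int (disc Q)" and ?q = "qtau Q \<tau>" and ?h = "height Q"
    have h: "?h \<ge> 1" by (rule height_ge_1)
    have fc: "floor_const > 0" by (rule floor_const_pos[OF r])
    have \<beta>: "beta_half k > 0" by (rule beta_half_pos[OF k])
    show "norm (if disc Q > 0 then of_int (disc Q) ^ n * (of_real (psi_part k (disc Q) ?q) * qexp (disc Q) z) else 0)
      \<le> B * A * norm ((if disc Q > 0 then of_int (disc Q) ^ (n + k) * qexp (disc Q) z else 0) *
          complex_of_real (height Q powr (1 - 2 * real k)))"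
    proof (cases "disc Q > 0")
      case True
      then have D: "?D \<ge> 1" by linarith
      let ?w = "?D / (?D + ?q\<^sup>2)"
      have w: "0 < ?w" "?w \<le> 1"
        using D add_pos_nonneg[OF _ zero_le_power2[of ?q], of ?D] by (auto simp: pos_divide_le_eq)
      have "?w \<le> ?D / (floor_const / 2 * ?h\<^sup>2)"
        using D fc h disc_plus_square_ge[OF r True] by (intro divide_left_mono mult_pos_pos add_pos_nonneg) auto
      also have "\<dots> = (2 / floor_const) * (?D * ?h powr (- 2))"
      proof -
        have "?h powr (- 2) = 1 / ?h\<^sup>2" by (simp add: powr_minus_divide)
        moreover have "a / (f / 2 * H) = 2 / f * (a * (1 / H))" for a f H :: real by simp
        ultimately show ?thesis by (simp only:)
      qed
      finally have "?w powr (real k - 1/2) \<le> ((2 / floor_const) * (?D * ?h powr (- 2))) powr (real k - 1/2)"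
        using w k by (intro powr_mono2) auto
      also have "\<dots> = A * (?D powr (real k - 1/2) * ?h powr (1 - 2 * real k))"
      proof -
        have "(?h powr (- 2)) powr (real k - 1/2) = ?h powr (1 - 2 * real k)"
          by (simp add: powr_powr algebra_simps)
        then show ?thesis
          using D fc powr_mult[of "2 / floor_const" "?D * ?h powr (- 2)" "real k - 1/2"]
            powr_mult[of ?D "?h powr (- 2)" "real k - 1/2"]
          by (simp only: A_def)
      qed
      also have "\<dots> \<le> A * (?D ^ k * ?h powr (1 - 2 * real k))"
        using D by (intro mult_left_mono mult_right_mono powr_minus_half_le) (auto simp: A_def)
      finally have wle: "?w powr (real k - 1/2) \<le> A * (?D ^ k * ?h powr (1 - 2 * real k))" .
      have "\<bar>psi_part k (disc Q) ?q\<bar> \<le> 2 / beta_half k * psi k ?w"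
        using psi_bounds(1)[OF k w] \<beta>
        by (auto simp: psi_part_def abs_mult abs_sgn_eq)
      also have "\<dots> \<le> 2 / beta_half k * ((2 + beta_half k * 2 ^ k) * ?w powr (real k - 1/2))"
        using \<beta> by (intro mult_left_mono psi_bounds(2)[OF k w]) auto
      also have "\<dots> = B * ?w powr (real k - 1/2)" by (simp add: B_def)
      also have "\<dots> \<le> B * (A * (?D ^ k * ?h powr (1 - 2 * real k)))"
        using \<beta> by (intro mult_left_mono wle) (auto simp: B_def)
      finally have "\<bar>psi_part k (disc Q) ?q\<bar> \<le> B * (A * (?D ^ k * ?h powr (1 - 2 * real k)))" .
      then have "?D ^ n * (\<bar>psi_part k (disc Q) ?q\<bar> * cmod (qexp (disc Q) z))
        \<le> ?D ^ n * (B * (A * (?D ^ k * ?h powr (1 - 2 * real k))) * cmod (qexp (disc Q) z))"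
        using D by (intro mult_left_mono mult_right_mono) auto
      then show ?thesis
        using True by (simp add: norm_mult norm_power power_add algebra_simps)
    qed simp
  qed
qed

lemma decay_cauchy_part:
  "decay (- 2 * real k) (\<lambda>Q \<tau> z. if disc Q > 0
     then of_real (of_int (disc Q) powr (real k - 1/2) / (of_int (disc Q) + (qtau Q \<tau>)\<^sup>2) ^ k) * qexp (disc Q) z else 0)"
proof -
  define A where "A = (2 / floor_const) ^ k"
  have "decay (0 + (- 2 * real k)) (\<lambda>Q \<tau> z.
      (if disc Q > 0 then of_int (disc Q) ^ k * qexp (disc Q) z else 0) *
      of_real (height Q powr (- 2 * real k)))"
    by (rule decay_mult[OF decay_disc_qexp decayI[where C = 1]]) simp
  then show ?thesis
    unfolding add_0
  proof (rule decay_dom[where c = A])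
    fix Q \<tau> z assume r: "reg Q \<tau> z"
    let ?D = "real_of_int (disc Q)" and ?q = "qtau Q \<tau>" and ?h = "height Q"
    have h: "?h \<ge> 1" by (rule height_ge_1)
    have fc: "floor_const > 0" by (rule floor_const_pos[OF r])
    show "norm (if disc Q > 0
     then of_real (?D powr (real k - 1/2) / (?D + ?q\<^sup>2) ^ k) * qexp (disc Q) z else 0)
      \<le> A * norm ((if disc Q > 0 then of_int (disc Q) ^ k * qexp (disc Q) z else 0) *
          complex_of_real (height Q powr (- 2 * real k)))"
    proof (cases "disc Q > 0")
      case True
      then have D: "?D \<ge> 1" by linarith
      have Dq: "?D + ?q\<^sup>2 > 0" using D by (intro add_pos_nonneg) auto
      have "?D powr (real k - 1/2) / (?D + ?q\<^sup>2) ^ k \<le> ?D ^ k / (floor_const / 2 * ?h\<^sup>2) ^ k"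
        using D fc h by (intro frac_le powr_minus_half_le power_mono disc_plus_square_ge[OF r True]) auto
      also have "\<dots> = A * (?D ^ k * ?h powr (- 2 * real k))"
      proof -
        have "?h powr (- 2 * real k) = inverse ((?h\<^sup>2) ^ k)"
          using powr_realpow[OF height_pos, of Q "2 * k"] by (simp add: powr_minus power_mult)
        moreover have "a / (f / 2 * H) ^ k = (2 / f) ^ k * (a * inverse (H ^ k))" for a f H :: real
          by (simp add: power_mult_distrib power_divide divide_simps)
        ultimately show ?thesis unfolding A_def by (simp only:)
      qed
      finally have le: "?D powr (real k - 1/2) / (?D + ?q\<^sup>2) ^ k \<le> A * (?D ^ k * ?h powr (- 2 * real k))" .
      define X where "X = ?D powr (real k - 1/2) / (?D + ?q\<^sup>2) ^ k"
      have X: "0 \<le> X" using Dq by (simp add: X_def)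
      have "norm (complex_of_real X * qexp (disc Q) z) = X * cmod (qexp (disc Q) z)"
        using X by (simp add: norm_mult)
      also have "\<dots> \<le> A * (?D ^ k * ?h powr (- 2 * real k)) * cmod (qexp (disc Q) z)"
        using le by (intro mult_right_mono) (simp_all add: X_def)
      finally show ?thesis
        unfolding X_def using True by (simp add: norm_mult norm_power algebra_simps)
    qed simp
  qed
qed

end

section \<open>Termwise derivatives\<close>

definition pterm :: "nat \<Rightarrow> qform \<Rightarrow> complex \<Rightarrow> complex \<Rightarrow> complex" where
  "pterm k Q \<tau> z = qeval Q \<tau> ^ (k - 1) *
     (of_real (pfun k (disc Q) (qtau Q \<tau>) (Im z)) * qexp (disc Q) z)"

text \<open>Here and in the next three definitions the differential of a term is split: the
  \<open>_hol\<close> part multiplies h complex-linearly and is annihilated by \<open>dbar\<close>,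
  while the \<open>_nonhol\<close> part comes from the real variable \<open>Im z\<close> or
  \<open>qtau\<close> and survives.\<close>

definition dz_nonhol :: "nat \<Rightarrow> qform \<Rightarrow> complex \<Rightarrow> complex \<Rightarrow> complex" where
  "dz_nonhol k Q \<tau> z = qeval Q \<tau> ^ (k - 1) * (of_real (pfun_v (qtau Q \<tau>) (Im z)) * qexp (disc Q) z)"

definition dz_hol :: "nat \<Rightarrow> qform \<Rightarrow> complex \<Rightarrow> complex \<Rightarrow> complex" where
  "dz_hol k Q \<tau> z = qeval Q \<tau> ^ (k - 1) * (2 * of_real pi * \<i> *
     (of_int (disc Q) * (of_real (pfun k (disc Q) (qtau Q \<tau>) (Im z)) * qexp (disc Q) z)))"

definition dtau_nonhol :: "nat \<Rightarrow> qform \<Rightarrow> complex \<Rightarrow> complex \<Rightarrow> complex" where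
  "dtau_nonhol k Q \<tau> z = qeval Q \<tau> ^ (k - 1) *
     (of_real (pfun_q k (disc Q) (qtau Q \<tau>) (Im z)) * qexp (disc Q) z)"

definition dtau_hol :: "nat \<Rightarrow> qform \<Rightarrow> complex \<Rightarrow> complex \<Rightarrow> complex" where
  "dtau_hol k Q \<tau> z = of_nat (k - 1) * (qeval Q \<tau> ^ (k - 2) * (qder Q \<tau> *
     (of_real (pfun k (disc Q) (qtau Q \<tau>) (Im z)) * qexp (disc Q) z)))"

lemma qexp_has_field_derivative:
  "(qexp D has_field_derivative (2 * of_real pi * \<i> * of_int D * qexp D z)) (at z)"
proof -
  have "qexp D = (\<lambda>z. exp (2 * of_real pi * \<i> * of_int D * z))"
    by (simp add: qexp_def fun_eq_iff)
  then show ?thesis by (auto intro!: derivative_eq_intros)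
qed

lemma pterm_has_derivative_z:
  assumes "Im z > 0"
  shows "((\<lambda>z. pterm k Q \<tau> z) has_derivative
    (\<lambda>h. dz_nonhol k Q \<tau> z * of_real (Im h) + dz_hol k Q \<tau> z * h)) (at z)"
proof -
  let ?D = "disc Q" and ?q = "qtau Q \<tau>"
  have "((\<lambda>z. pfun k ?D ?q (Im z)) has_derivative (\<lambda>h. pfun_v ?q (Im z) * Im h)) (at z)"
    using has_derivative_compose[OF has_derivative_Im[OF has_derivative_ident]
        pfun_deriv_v[OF assms, of k ?D ?q, unfolded has_field_derivative_def]] .
  then have P: "((\<lambda>z. complex_of_real (pfun k ?D ?q (Im z))) has_derivative
      (\<lambda>h. of_real (pfun_v ?q (Im z) * Im h))) (at z)"
    by (rule has_derivative_of_real)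
  have E: "(qexp ?D has_derivative (\<lambda>h. 2 * of_real pi * \<i> * of_int ?D * qexp ?D z * h)) (at z)"
    using qexp_has_field_derivative[of ?D z] unfolding has_field_derivative_def by simp
  show ?thesis
    unfolding pterm_def
    by (rule has_derivative_eq_rhs[OF has_derivative_mult_right[OF has_derivative_mult[OF P E]]])
       (simp add: fun_eq_iff dz_nonhol_def dz_hol_def algebra_simps)
qed

lemma pterm_has_derivative_tau:
  assumes "k \<ge> 2" "Im \<tau> > 0" "Im z > 0" "disc Q > 0 \<or> qtau Q \<tau> \<noteq> 0"
  shows "((\<lambda>\<tau>. pterm k Q \<tau> z) has_derivative
    (\<lambda>h. dtau_nonhol k Q \<tau> z * of_real (Im (qeval Q \<tau> * cnj h) / (Im \<tau>)\<^sup>2) + dtau_hol k Q \<tau> z * h)) (at \<tau>)"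
proof -
  let ?D = "disc Q" and ?q = "qtau Q \<tau>"
  have "((\<lambda>q. pfun k ?D q (Im z)) has_real_derivative pfun_q k ?D ?q (Im z)) (at ?q)"
    using assms by (intro pfun_deriv_q) auto
  from has_derivative_compose[OF qtau_has_derivative[OF assms(2)] this[unfolded has_field_derivative_def]]
  have "((\<lambda>\<tau>. pfun k ?D (qtau Q \<tau>) (Im z)) has_derivative
      (\<lambda>h. pfun_q k ?D ?q (Im z) * (Im (qeval Q \<tau> * cnj h) / (Im \<tau>)\<^sup>2))) (at \<tau>)" .
  then have P: "((\<lambda>\<tau>. complex_of_real (pfun k ?D (qtau Q \<tau>) (Im z))) has_derivative
      (\<lambda>h. of_real (pfun_q k ?D ?q (Im z) * (Im (qeval Q \<tau> * cnj h) / (Im \<tau>)\<^sup>2)))) (at \<tau>)"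
    by (rule has_derivative_of_real)
  have "((\<lambda>\<tau>. qeval Q \<tau> ^ (k - 1)) has_field_derivative
      (of_nat (k - 1) * (qder Q \<tau> * qeval Q \<tau> ^ (k - 1 - Suc 0)))) (at \<tau>)"
    by (rule DERIV_power[OF qeval_has_field_derivative])
  moreover have "k - 1 - Suc 0 = k - 2" by simp
  ultimately have Z: "((\<lambda>\<tau>. qeval Q \<tau> ^ (k - 1)) has_derivative
      (\<lambda>h. of_nat (k - 1) * (qder Q \<tau> * qeval Q \<tau> ^ (k - 2)) * h)) (at \<tau>)"
    unfolding has_field_derivative_def by simp
  show ?thesis
    unfolding pterm_def
    by (rule has_derivative_eq_rhs[OF has_derivative_mult[OF Z has_derivative_mult_left[OF P]]])
       (simp add: fun_eq_iff dtau_nonhol_def dtau_hol_def algebra_simps)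
qed

lemma qeval_zero_form [simp]: "qeval (0, 0, 0) \<tau> = 0"
  by (simp add: qeval_def)

context region
begin

lemma decay_norm: "decay s f \<Longrightarrow> decay s (\<lambda>Q \<tau> z. norm (f Q \<tau> z))"
  by (rule decay_cong) auto

lemma decay_cmult: "decay s f \<Longrightarrow> decay s (\<lambda>Q \<tau> z. c * f Q \<tau> z)"
  for f :: "qform \<Rightarrow> complex \<Rightarrow> complex \<Rightarrow> 'a::real_normed_algebra"
  using decay_mult[OF decay_const] by (simp only: add_0)

lemma decay_gamma_part:
  "decay s (\<lambda>Q \<tau> z. of_real (gamma_part (qtau Q \<tau>) (Im z)) * qexp (disc Q) z)"
proof (rule decay_dom[OF decay_gauss, where c = "exp 1"])
  fix Q \<tau> z assume r: "reg Q \<tau> z"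
  let ?w = "4 * pi * (qtau Q \<tau>)\<^sup>2 * Im z"
  have w: "?w \<ge> 0" using r v_pos by (simp add: reg_def)
  have "\<bar>gamma_part (qtau Q \<tau>) (Im z)\<bar> \<le> 1 / sqrt pi * inc_Gamma (1/2) ?w"
    using inc_Gamma_half_nonneg by (simp add: gamma_part_def abs_mult abs_sgn_eq)
  also have "\<dots> \<le> 1 / sqrt pi * (sqrt pi * exp 1 * exp (- ?w))"
    by (intro mult_left_mono inc_Gamma_half_le w) simp
  also have "\<dots> = exp 1 * exp (- ?w)" by simp
  finally have "\<bar>gamma_part (qtau Q \<tau>) (Im z)\<bar> * cmod (qexp (disc Q) z)
      \<le> exp 1 * exp (- ?w) * cmod (qexp (disc Q) z)"
    by (rule mult_right_mono) simp
  then show "norm (complex_of_real (gamma_part (qtau Q \<tau>) (Im z)) * qexp (disc Q) z)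
     \<le> exp 1 * norm (complex_of_real (exp (- 4 * pi * (qtau Q \<tau>)\<^sup>2 * Im z)) * qexp (disc Q) z)"
    by (simp add: norm_mult)
qed

text \<open>The case n = 0 serves the terms themselves, n = 1 the holomorphic derivative in z, which
  brings down a factor D.\<close>

lemma decay_disc_pow_pfun:
  assumes "k \<ge> 1"
  shows "decay (1 - 2 * real k) (\<lambda>Q \<tau> z. of_int (disc Q) ^ n *
    (of_real (pfun k (disc Q) (qtau Q \<tau>) (Im z)) * qexp (disc Q) z))"
proof -
  \<comment> \<open>The Gamma part has every order, so its order is chosen to compensate the order
    2n of D^n.\<close>
  have "decay (real n * 2 + (1 - 2 * real k - real n * 2)) (\<lambda>Q \<tau> z. of_int (disc Q) ^ n *
    (of_real (gamma_part (qtau Q \<tau>) (Im z)) * qexp (disc Q) z))"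
    by (intro decay_mult decay_power decay_disc decay_gamma_part)
  then have G: "decay (1 - 2 * real k) (\<lambda>Q \<tau> z. of_int (disc Q) ^ n *
    (of_real (gamma_part (qtau Q \<tau>) (Im z)) * qexp (disc Q) z))" by simp
  show ?thesis
  proof (rule decay_cong[OF decay_add[OF decay_psi_part[OF assms, of n] G]])
    fix Q \<tau> z assume r: "reg Q \<tau> z"
    then have "Im z \<ge> 0" using v_pos by (simp add: reg_def)
    then show "norm (of_int (disc Q) ^ n *
        (of_real (pfun k (disc Q) (qtau Q \<tau>) (Im z)) * qexp (disc Q) z)) =
      norm ((if disc Q > 0
         then of_int (disc Q) ^ n * (of_real (psi_part k (disc Q) (qtau Q \<tau>)) * qexp (disc Q) z) else 0) +
         of_int (disc Q) ^ n * (of_real (gamma_part (qtau Q \<tau>) (Im z)) * qexp (disc Q) z))"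
      using assms by (simp add: pfun_eq algebra_simps)
  qed
qed

lemma decay_sqrt_Im: "decay 0 (\<lambda>Q \<tau> z. complex_of_real (sqrt (Im z)))"
  by (rule decayI[where C = "sqrt V"]) (use v_pos in \<open>auto simp: reg_def\<close>)

lemma decay_inverse_sqrt_Im: "decay 0 (\<lambda>Q \<tau> z. complex_of_real (inverse (sqrt (Im z))))"
proof (rule decayI[where C = "inverse (sqrt v)"])
  fix Q \<tau> z assume "reg Q \<tau> z"
  then have "v \<le> Im z" by (simp add: reg_def)
  then have "inverse (sqrt (Im z)) \<le> inverse (sqrt v)"
    using v_pos by (intro le_imp_inverse_le) auto
  then show "norm (complex_of_real (inverse (sqrt (Im z)))) \<le> inverse (sqrt v) * height Q powr 0"
    unfolding norm_of_real using v_pos \<open>v \<le> Im z\<close> by simp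
qed

lemma decay_theta:
  "decay s (\<lambda>Q \<tau> z. of_real (4 * sqrt (Im z)) *
     (of_real (exp (- 4 * pi * (qtau Q \<tau>)\<^sup>2 * Im z)) * qexp (disc Q) z))"
proof -
  have "decay (0 + s) (\<lambda>Q \<tau> z. (4 * of_real (sqrt (Im z))) *
     (of_real (exp (- 4 * pi * (qtau Q \<tau>)\<^sup>2 * Im z)) * qexp (disc Q) z))"
    by (intro decay_mult[OF decay_cmult[OF decay_sqrt_Im] decay_gauss])
  then show ?thesis by simp
qed

lemma decay_pfun_q:
  "decay (- 2 * real k) (\<lambda>Q \<tau> z. of_real (pfun_q k (disc Q) (qtau Q \<tau>) (Im z)) * qexp (disc Q) z)"
proof (rule decay_cong[OF decay_add[OF decay_theta
        decay_cmult[OF decay_cauchy_part, where c = "- of_real (2 / beta_half k)"]]])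
  fix Q \<tau> z
  show "norm (of_real (pfun_q k (disc Q) (qtau Q \<tau>) (Im z)) * qexp (disc Q) z) =
    norm (of_real (4 * sqrt (Im z)) * (of_real (exp (- 4 * pi * (qtau Q \<tau>)\<^sup>2 * Im z)) * qexp (disc Q) z) +
      - of_real (2 / beta_half k) * (if disc Q > 0
       then of_real (of_int (disc Q) powr (real k - 1/2) / (of_int (disc Q) + (qtau Q \<tau>)\<^sup>2) ^ k) * qexp (disc Q) z
       else 0))"
    by (rule arg_cong[where f = norm])
       (cases "disc Q > 0"; simp only: pfun_q_def if_True if_False of_real_diff of_real_mult
         left_diff_distrib mult_minus_left mult_zero_right diff_0_right mult.assoc
         add_uminus_conv_diff minus_zero add_0_right of_real_0)
qed

lemma decay_pfun_v:
  "decay s (\<lambda>Q \<tau> z. of_real (pfun_v (qtau Q \<tau>) (Im z)) * qexp (disc Q) z)"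
proof -
  have "decay (1 + (0 + (s - 1))) (\<lambda>Q \<tau> z. (2 * of_real (qtau Q \<tau>)) * (of_real (inverse (sqrt (Im z))) *
     (of_real (exp (- 4 * pi * (qtau Q \<tau>)\<^sup>2 * Im z)) * qexp (disc Q) z)))"
    by (intro decay_mult[OF decay_cmult[OF decay_of_real[OF decay_qtau]]
          decay_mult[OF decay_inverse_sqrt_Im decay_gauss]])
  then show ?thesis
    by (simp add: pfun_v_def divide_inverse mult.assoc)
qed

lemma decay_qeval_pow:
  fixes f :: "qform \<Rightarrow> complex \<Rightarrow> complex \<Rightarrow> complex"
  assumes "decay t f" "real n + t \<le> s"
  shows "decay s (\<lambda>Q \<tau> z. qeval Q \<tau> ^ n * f Q \<tau> z)"
  by (rule decay_mono[OF decay_mult[OF decay_power[OF decay_qeval] assms(1)]])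
     (use assms(2) in simp)

text \<open>The counts are (k - 1) + (1 - 2k) for the term and for \<open>dz_hol\<close>, (k - 2) +
  1 + (1 - 2k) for \<open>dtau_hol\<close>, and k - 2k for \<open>dtau_nonhol\<close> with the
  factor \<open>qeval\<close> from the derivative of \<open>qtau\<close>. All equal -k;
  \<open>dz_nonhol\<close> is Gaussian.\<close>

lemma decay_pterm:
  assumes "k \<ge> 2"
  shows "decay (- real k) (pterm k)"
    and "decay (- real k) (dz_nonhol k)"
    and "decay (- real k) (dz_hol k)"
    and "decay (- real k) (\<lambda>Q \<tau> z. qeval Q \<tau> * dtau_nonhol k Q \<tau> z)"
    and "decay (- real k) (dtau_hol k)"
proof -
  have k1: "k \<ge> 1" using assms by simp
  have "decay (- real k) (\<lambda>Q \<tau> z. pterm k Q \<tau> z)"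
    unfolding pterm_def using decay_disc_pow_pfun[OF k1, of 0] k1
    by (intro decay_qeval_pow[of "1 - 2 * real k"]) (auto simp: of_nat_diff)
  then show "decay (- real k) (pterm k)" .
  have "decay (- real k) (\<lambda>Q \<tau> z. dz_nonhol k Q \<tau> z)"
    unfolding dz_nonhol_def using decay_pfun_v k1
    by (intro decay_qeval_pow[of "- 2 * real k"]) (auto simp: of_nat_diff)
  then show "decay (- real k) (dz_nonhol k)" .
  have "decay (- real k) (\<lambda>Q \<tau> z. dz_hol k Q \<tau> z)"
    unfolding dz_hol_def using decay_disc_pow_pfun[OF k1, of 1] k1
    by (intro decay_qeval_pow[of "1 - 2 * real k"] decay_cmult) (auto simp: of_nat_diff)
  then show "decay (- real k) (dz_hol k)" .
  have "decay (- real k) (\<lambda>Q \<tau> z. qeval Q \<tau> ^ k *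
     (of_real (pfun_q k (disc Q) (qtau Q \<tau>) (Im z)) * qexp (disc Q) z))"
    by (intro decay_qeval_pow[OF decay_pfun_q]) auto
  then show "decay (- real k) (\<lambda>Q \<tau> z. qeval Q \<tau> * dtau_nonhol k Q \<tau> z)"
  proof (rule decay_cong)
    show "norm (qeval Q \<tau> * dtau_nonhol k Q \<tau> z) = norm (qeval Q \<tau> ^ k *
     (of_real (pfun_q k (disc Q) (qtau Q \<tau>) (Im z)) * qexp (disc Q) z))" for Q \<tau> z
      using power_Suc[of "qeval Q \<tau>" "k - 1"] k1 unfolding dtau_nonhol_def mult.assoc[symmetric]
      by simp
  qed
  have "decay (- real k) (\<lambda>Q \<tau> z. dtau_hol k Q \<tau> z)"
    unfolding dtau_hol_def using decay_mult[OF decay_qder decay_disc_pow_pfun[OF k1, of 0]] assms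
    by (intro decay_qeval_pow[of "1 + (1 - 2 * real k)"] decay_cmult) (auto simp: of_nat_diff)
  then show "decay (- real k) (dtau_hol k)" .
qed

lemma decay_summable:
  fixes f :: "qform \<Rightarrow> complex \<Rightarrow> complex \<Rightarrow> 'a::banach"
  assumes "decay s f" "s < - 3" "y \<le> Im \<tau>" "cmod \<tau> \<le> R" "v \<le> Im z" "Im z \<le> V"
  shows "(\<lambda>Q. f Q \<tau> z) summable_on - {(0, 0, 0)}"
proof -
  obtain C where C: "\<And>Q \<tau> z. reg Q \<tau> z \<Longrightarrow> norm (f Q \<tau> z) \<le> C * height Q powr s"
    using assms(1) by (rule decayE) blast
  have "(\<lambda>Q. C * height Q powr s) summable_on - {(0, 0, 0)}"
    by (intro summable_on_cmult_right summable_on_height assms)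
  then have "(\<lambda>Q. norm (f Q \<tau> z)) summable_on - {(0, 0, 0)}"
  proof (rule Infinite_Sum.abs_summable_on_comparison_test')
    fix Q :: qform assume "Q \<in> - {(0, 0, 0)}"
    then show "norm (f Q \<tau> z) \<le> C * height Q powr s"
      using assms by (intro C) (simp add: reg_def)
  qed
  then show ?thesis by (rule abs_summable_summable)
qed

text \<open>The inequalities for z are strict so that z lies in an open convex strip; \<tau> is
  fixed and may lie on the boundary of its range.\<close>

lemma sum_pterm_has_derivative_z:
  assumes k: "k \<ge> 4" and r: "y \<le> Im \<tau>" "cmod \<tau> \<le> R" "v < Im z" "Im z < V"
  shows "(\<lambda>Q. dz_nonhol k Q \<tau> z * of_real (Im h) + dz_hol k Q \<tau> z * h) summable_on - {(0, 0, 0)}"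
    and "((\<lambda>z. \<Sum>\<^sub>\<infinity>Q\<in>- {(0, 0, 0)}. pterm k Q \<tau> z) has_derivative
      (\<lambda>h. \<Sum>\<^sub>\<infinity>Q\<in>- {(0, 0, 0)}. dz_nonhol k Q \<tau> z * of_real (Im h) + dz_hol k Q \<tau> z * h)) (at z)"
proof -
  have k2: "k \<ge> 2" using k by simp
  have "decay (- real k) (\<lambda>Q \<tau> z. norm (dz_nonhol k Q \<tau> z) + norm (dz_hol k Q \<tau> z))"
    by (intro decay_add decay_norm decay_pterm k2)
  then obtain C where C: "C \<ge> 0" "\<And>Q \<tau> z. reg Q \<tau> z \<Longrightarrow>
      norm (norm (dz_nonhol k Q \<tau> z) + norm (dz_hol k Q \<tau> z)) \<le> C * height Q powr (- real k)"
    by (rule decayE) blast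
  let ?S = "{z. v < Im z} \<inter> {z. Im z < V}"
  have S: "open ?S" "convex ?S" "z \<in> ?S"
    using r by (auto intro: open_halfspace_Im_gt open_halfspace_Im_lt convex_Int
        convex_halfspace_Im_gt convex_halfspace_Im_lt)
  have bound: "norm (dz_nonhol k Q \<tau> w * of_real (Im h) + dz_hol k Q \<tau> w * h)
      \<le> C * height Q powr (- real k) * norm h" if "Q \<in> - {(0, 0, 0)}" "w \<in> ?S" for Q w h
  proof -
    have "norm (dz_nonhol k Q \<tau> w * of_real (Im h) + dz_hol k Q \<tau> w * h)
        \<le> norm (dz_nonhol k Q \<tau> w) * norm h + norm (dz_hol k Q \<tau> w) * norm h"
      by (intro norm_triangle_le add_mono) (auto simp: norm_mult abs_Im_le_cmod mult_left_mono)
    also have "\<dots> = (norm (dz_nonhol k Q \<tau> w) + norm (dz_hol k Q \<tau> w)) * norm h"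
      by (simp add: distrib_right)
    also have "\<dots> \<le> C * height Q powr (- real k) * norm h"
      using C(2)[of Q \<tau> w] that r by (intro mult_right_mono) (auto simp: reg_def)
    finally show ?thesis .
  qed
  have der: "((\<lambda>z. pterm k Q \<tau> z) has_derivative
      (\<lambda>h. dz_nonhol k Q \<tau> w * of_real (Im h) + dz_hol k Q \<tau> w * h)) (at w)" if "w \<in> ?S" for Q w
    using that v_pos by (intro pterm_has_derivative_z) auto
  have M: "(\<lambda>Q. C * height Q powr (- real k)) summable_on - {(0, 0, 0)}"
    using k by (intro summable_on_cmult_right summable_on_height) auto
  have summ: "(\<lambda>Q. pterm k Q \<tau> w) summable_on - {(0, 0, 0)}" if "w \<in> ?S" for w
    by (rule decay_summable[OF decay_pterm(1)[OF k2]]) (use that r k in auto)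
  note * = has_derivative_infsum[where f = "\<lambda>Q z. pterm k Q \<tau> z"
      and f' = "\<lambda>Q w h. dz_nonhol k Q \<tau> w * of_real (Im h) + dz_hol k Q \<tau> w * h",
      OF S der bound M _ summ]
  show "(\<lambda>Q. dz_nonhol k Q \<tau> z * of_real (Im h) + dz_hol k Q \<tau> z * h) summable_on - {(0, 0, 0)}"
    by (rule *(1)) (use C(1) in auto)
  show "((\<lambda>z. \<Sum>\<^sub>\<infinity>Q\<in>- {(0, 0, 0)}. pterm k Q \<tau> z) has_derivative
      (\<lambda>h. \<Sum>\<^sub>\<infinity>Q\<in>- {(0, 0, 0)}. dz_nonhol k Q \<tau> z * of_real (Im h) + dz_hol k Q \<tau> z * h)) (at z)"
    by (rule *(2)) (use C(1) in auto)
qed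

lemma sum_pterm_has_derivative_tau:
  assumes k: "k \<ge> 4" and r: "y < Im \<tau>" "cmod \<tau> < R" "v \<le> Im z" "Im z \<le> V"
  shows "(\<lambda>Q. dtau_nonhol k Q \<tau> z * of_real (Im (qeval Q \<tau> * cnj h) / (Im \<tau>)\<^sup>2) + dtau_hol k Q \<tau> z * h)
      summable_on - {(0, 0, 0)}"
    and "((\<lambda>\<tau>. \<Sum>\<^sub>\<infinity>Q\<in>- {(0, 0, 0)}. pterm k Q \<tau> z) has_derivative
      (\<lambda>h. \<Sum>\<^sub>\<infinity>Q\<in>- {(0, 0, 0)}.
        dtau_nonhol k Q \<tau> z * of_real (Im (qeval Q \<tau> * cnj h) / (Im \<tau>)\<^sup>2) + dtau_hol k Q \<tau> z * h)) (at \<tau>)"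
proof -
  have k2: "k \<ge> 2" using k by simp
  have "decay (- real k) (\<lambda>Q \<tau> z. 1 / y\<^sup>2 * norm (qeval Q \<tau> * dtau_nonhol k Q \<tau> z) + norm (dtau_hol k Q \<tau> z))"
    by (intro decay_add decay_cmult decay_norm decay_pterm k2)
  then obtain C where C: "C \<ge> 0" "\<And>Q \<tau> z. reg Q \<tau> z \<Longrightarrow>
      norm (1 / y\<^sup>2 * norm (qeval Q \<tau> * dtau_nonhol k Q \<tau> z) + norm (dtau_hol k Q \<tau> z)) \<le> C * height Q powr (- real k)"
    by (rule decayE) blast
  let ?S = "{\<tau>. y < Im \<tau>} \<inter> ball 0 R"
  have S: "open ?S" "convex ?S" "\<tau> \<in> ?S"
    using r by (auto intro: open_halfspace_Im_gt convex_Int convex_halfspace_Im_gt)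
  have bound: "norm (dtau_nonhol k Q w z * of_real (Im (qeval Q w * cnj h) / (Im w)\<^sup>2) + dtau_hol k Q w z * h)
      \<le> C * height Q powr (- real k) * norm h" if "Q \<in> - {(0, 0, 0)}" "w \<in> ?S" for Q w h
  proof -
    \<comment> \<open>The differential of \<open>qtau\<close> carries the inverse square of the
      imaginary part, bounded through y.\<close>
    have yw: "1 / (Im w)\<^sup>2 \<le> 1 / y\<^sup>2"
      using that y_pos by (intro divide_left_mono power_mono mult_pos_pos zero_less_power) auto
    have "\<bar>Im (qeval Q w * cnj h)\<bar> \<le> norm (qeval Q w) * norm h"
      using abs_Im_le_cmod[of "qeval Q w * cnj h"] by (simp add: norm_mult)
    then have "norm (complex_of_real (Im (qeval Q w * cnj h) / (Im w)\<^sup>2)) \<le> norm (qeval Q w) * norm h * (1 / y\<^sup>2)"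
      unfolding norm_of_real abs_divide using mult_mono[OF _ yw] by fastforce
    then have "norm (dtau_nonhol k Q w z * of_real (Im (qeval Q w * cnj h) / (Im w)\<^sup>2) + dtau_hol k Q w z * h)
        \<le> norm (dtau_nonhol k Q w z) * (norm (qeval Q w) * norm h * (1 / y\<^sup>2)) + norm (dtau_hol k Q w z) * norm h"
      unfolding norm_mult[symmetric, of "dtau_hol k Q w z"]
      by (intro norm_triangle_le add_mono order_refl) (simp only: norm_mult mult_left_mono norm_ge_zero)
    also have "\<dots> = (1 / y\<^sup>2 * norm (qeval Q w * dtau_nonhol k Q w z) + norm (dtau_hol k Q w z)) * norm h"
      by (simp add: norm_mult algebra_simps)
    also have "\<dots> \<le> C * height Q powr (- real k) * norm h"
      using C(2)[of Q w z] that r by (intro mult_right_mono) (auto simp: reg_def)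
    finally show ?thesis .
  qed
  have der: "((\<lambda>\<tau>. pterm k Q \<tau> z) has_derivative
      (\<lambda>h. dtau_nonhol k Q w z * of_real (Im (qeval Q w * cnj h) / (Im w)\<^sup>2) + dtau_hol k Q w z * h)) (at w)"
    if "Q \<in> - {(0, 0, 0)}" "w \<in> ?S" for Q w
  proof (rule pterm_has_derivative_tau[OF k2])
    show "disc Q > 0 \<or> qtau Q w \<noteq> 0"
      by (rule qtau_or_disc[of Q w z]) (use that r in \<open>auto simp: reg_def\<close>)
  qed (use that r y_pos v_pos in auto)
  have M: "(\<lambda>Q. C * height Q powr (- real k)) summable_on - {(0, 0, 0)}"
    using k by (intro summable_on_cmult_right summable_on_height) auto
  have summ: "(\<lambda>Q. pterm k Q w z) summable_on - {(0, 0, 0)}" if "w \<in> ?S" for w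
    by (rule decay_summable[OF decay_pterm(1)[OF k2]]) (use that r k in auto)
  note * = has_derivative_infsum[where f = "\<lambda>Q w. pterm k Q w z"
      and f' = "\<lambda>Q w h. dtau_nonhol k Q w z * of_real (Im (qeval Q w * cnj h) / (Im w)\<^sup>2) + dtau_hol k Q w z * h",
      OF S der bound M _ summ]
  show "(\<lambda>Q. dtau_nonhol k Q \<tau> z * of_real (Im (qeval Q \<tau> * cnj h) / (Im \<tau>)\<^sup>2) + dtau_hol k Q \<tau> z * h)
      summable_on - {(0, 0, 0)}"
    by (rule *(1)) (use C(1) in auto)
  show "((\<lambda>\<tau>. \<Sum>\<^sub>\<infinity>Q\<in>- {(0, 0, 0)}. pterm k Q \<tau> z) has_derivative
      (\<lambda>h. \<Sum>\<^sub>\<infinity>Q\<in>- {(0, 0, 0)}.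
        dtau_nonhol k Q \<tau> z * of_real (Im (qeval Q \<tau> * cnj h) / (Im \<tau>)\<^sup>2) + dtau_hol k Q \<tau> z * h)) (at \<tau>)"
    by (rule *(2)) (use C(1) in auto)
qed

end

section \<open>Identification of the series\<close>

text \<open>The partial derivatives are the values of the real-linear differential at 1 and \<i>.
  For h \<mapsto> c h the result is (c + \<i> * \<i> * c) / 2 = 0, so complex-linear parts drop
  out.\<close>

lemma dbar_eq:
  assumes "(f has_derivative f') (at w)"
  shows "dbar f w = (f' 1 + \<i> * f' \<i>) / 2"
proof -
  have 1: "((\<lambda>x. f (Complex x (Im w))) has_vector_derivative f' 1) (at (Re w))"
  proof -
    have "((\<lambda>x. Complex x (Im w)) has_derivative (\<lambda>h. of_real h)) (at (Re w))"
      unfolding Complex_eq by (auto intro!: derivative_eq_intros)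
    then have "((\<lambda>x. f (Complex x (Im w))) has_derivative (\<lambda>h. f' (of_real h))) (at (Re w))"
      by (rule has_derivative_compose) (use assms in simp)
    then show ?thesis
      using linear_scale[OF has_derivative_linear[OF assms], of _ 1]
      by (simp add: has_vector_derivative_def of_real_def)
  qed
  have 2: "((\<lambda>t. f (Complex (Re w) t)) has_vector_derivative f' \<i>) (at (Im w))"
  proof -
    have "((\<lambda>t. Complex (Re w) t) has_derivative (\<lambda>h. h *\<^sub>R \<i>)) (at (Im w))"
      unfolding Complex_eq scaleR_conv_of_real by (auto intro!: derivative_eq_intros)
    then have "((\<lambda>t. f (Complex (Re w) t)) has_derivative (\<lambda>h. f' (h *\<^sub>R \<i>))) (at (Im w))"
      by (rule has_derivative_compose) (use assms in simp)
    then show ?thesis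
      using linear_scale[OF has_derivative_linear[OF assms], of _ \<i>]
      by (simp add: has_vector_derivative_def)
  qed
  show ?thesis
    unfolding dbar_def vector_derivative_at[OF 1] vector_derivative_at[OF 2] ..
qed

lemma dbar_infsum:
  fixes f' :: "'i \<Rightarrow> complex \<Rightarrow> complex"
  assumes "(f has_derivative (\<lambda>h. \<Sum>\<^sub>\<infinity>i\<in>A. f' i h)) (at w)" "\<And>h. (\<lambda>i. f' i h) summable_on A"
  shows "dbar f w = (\<Sum>\<^sub>\<infinity>i\<in>A. (f' i 1 + \<i> * f' i \<i>) / 2)"
proof -
  have "(\<Sum>\<^sub>\<infinity>i\<in>A. (f' i 1 + \<i> * f' i \<i>) / 2) = (\<Sum>\<^sub>\<infinity>i\<in>A. (f' i 1 + \<i> * f' i \<i>) * (1 / 2))"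
    by simp
  also have "\<dots> = (\<Sum>\<^sub>\<infinity>i\<in>A. f' i 1 + \<i> * f' i \<i>) * (1 / 2)"
    by (rule infsum_cmult_left')
  also have "\<dots> = ((\<Sum>\<^sub>\<infinity>i\<in>A. f' i 1) + (\<Sum>\<^sub>\<infinity>i\<in>A. \<i> * f' i \<i>)) * (1 / 2)"
    by (simp only: infsum_add[OF assms(2) summable_on_cmult_right[OF assms(2)]])
  finally show ?thesis
    unfolding dbar_eq[OF assms(1)] infsum_cmult_right' by simp
qed

text \<open>Exchanges the index sets of the definitions, which may contain the zero form, for the
  one on which the decay estimates hold.\<close>

lemma infsum_nonzero_forms:
  fixes g :: "qform \<Rightarrow> 'a::banach"
  assumes "\<And>Q. Q \<noteq> (0, 0, 0) \<Longrightarrow> Q \<notin> A \<Longrightarrow> g Q = 0" "(0, 0, 0) \<in> A \<Longrightarrow> g (0, 0, 0) = 0"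
  shows "infsum g A = infsum g (- {(0, 0, 0)})"
    and "g summable_on A \<longleftrightarrow> g summable_on (- {(0, 0, 0)})"
  by (intro infsum_cong_neutral summable_on_cong_neutral; use assms in auto)+

context
  fixes k :: nat and \<tau> z :: complex
  assumes k: "k \<ge> 4" and \<tau>: "Im \<tau> > 0" and z: "Im z > 0"
begin

text \<open>The bounds are attained at the point itself: only summability at fixed \<tau> and z is
  at stake here.\<close>

interpretation region "Im \<tau>" "cmod \<tau>" "Im z" "Im z"
  using \<tau> z by unfold_locales

lemma decay_nonzero_summable:
  fixes f :: "qform \<Rightarrow> complex \<Rightarrow> complex \<Rightarrow> 'a::banach"
  assumes "decay (- real k) f"
  shows "(\<lambda>Q. f Q \<tau> z) summable_on - {(0, 0, 0)}"
  by (rule decay_summable[OF assms]) (use k in auto)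

lemma Psi_eq:
  "(\<lambda>Q. qeval Q \<tau> ^ (k - 1) * (if disc Q > 0 then of_real (psi_part k (disc Q) (qtau Q \<tau>)) * qexp (disc Q) z else 0))
     summable_on - {(0, 0, 0)}"
  "Psi k \<tau> z = (\<Sum>\<^sub>\<infinity>Q\<in>- {(0, 0, 0)}. qeval Q \<tau> ^ (k - 1) *
     (if disc Q > 0 then of_real (psi_part k (disc Q) (qtau Q \<tau>)) * qexp (disc Q) z else 0))"
proof -
  let ?F = "\<lambda>Q. qeval Q \<tau> ^ (k - 1) *
    (if disc Q > 0 then of_real (psi_part k (disc Q) (qtau Q \<tau>)) * qexp (disc Q) z else 0)"
  have "decay (1 - 2 * real k) (\<lambda>Q \<tau> z.
      if disc Q > 0 then of_real (psi_part k (disc Q) (qtau Q \<tau>)) * qexp (disc Q) z else 0)"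
    using decay_psi_part[of k 0] k by (simp cong: if_cong)
  then have "decay (- real k) (\<lambda>Q \<tau> z. qeval Q \<tau> ^ (k - 1) *
    (if disc Q > 0 then of_real (psi_part k (disc Q) (qtau Q \<tau>)) * qexp (disc Q) z else 0))"
    by (rule decay_qeval_pow) (use k in \<open>simp add: of_nat_diff\<close>)
  from decay_nonzero_summable[OF this] show S: "?F summable_on - {(0, 0, 0)}" .
  let ?f = "\<lambda>D Q. of_real (2 / beta_half k) *
      (of_real (sgn (qtau Q \<tau>)) * qeval Q \<tau> ^ (k - 1) *
        of_real (psi k (of_int D * (Im \<tau>)\<^sup>2 / (cmod (qeval Q \<tau>))\<^sup>2))) * qexp D z"
  have "Psi k \<tau> z = (\<Sum>\<^sub>\<infinity>D\<in>{0<..}. \<Sum>\<^sub>\<infinity>Q\<in>forms_of_disc D. ?f D Q)"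
    unfolding Psi_def local_form_def infsum_cmult_left' infsum_cmult_right' ..
  also have "\<dots> = infsum ?F {Q. disc Q \<in> {0<..}}"
  proof (rule infsum_by_disc)
    show "?F summable_on {Q. disc Q \<in> {0<..}}"
      by (subst infsum_nonzero_forms(2)) (use S in \<open>auto simp: disc_def\<close>)
    fix Q assume "disc Q \<in> {0<..}"
    then have D: "disc Q > 0" by simp
    have "of_int (disc Q) * (Im \<tau>)\<^sup>2 / (cmod (qeval Q \<tau>))\<^sup>2 = of_int (disc Q) / (of_int (disc Q) + (qtau Q \<tau>)\<^sup>2)"
      unfolding cmod_qeval_square[OF \<tau>] using \<tau> by simp
    then show "?f (disc Q) Q = ?F Q"
      using D by (simp add: psi_part_def)
  qed
  also have "\<dots> = infsum ?F (- {(0, 0, 0)})"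
    by (rule infsum_nonzero_forms) (auto simp: disc_def)
  finally show "Psi k \<tau> z = infsum ?F (- {(0, 0, 0)})" .
qed

lemma Psi_star_eq:
  "(\<lambda>Q. qeval Q \<tau> ^ (k - 1) * (of_real (gamma_part (qtau Q \<tau>) (Im z)) * qexp (disc Q) z))
     summable_on - {(0, 0, 0)}"
  "Psi_star k \<tau> z = (\<Sum>\<^sub>\<infinity>Q\<in>- {(0, 0, 0)}. qeval Q \<tau> ^ (k - 1) *
     (of_real (gamma_part (qtau Q \<tau>) (Im z)) * qexp (disc Q) z))"
proof -
  let ?G = "\<lambda>Q. qeval Q \<tau> ^ (k - 1) * (of_real (gamma_part (qtau Q \<tau>) (Im z)) * qexp (disc Q) z)"
  have G0: "?G (0, 0, 0) = 0" using k by simp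
  have "decay (- real k) (\<lambda>Q \<tau> z. qeval Q \<tau> ^ (k - 1) *
    (of_real (gamma_part (qtau Q \<tau>) (Im z)) * qexp (disc Q) z))"
    by (rule decay_qeval_pow[OF decay_gamma_part[of "1 - 2 * real k"]]) (use k in \<open>simp add: of_nat_diff\<close>)
  from decay_nonzero_summable[OF this] show S: "?G summable_on - {(0, 0, 0)}" .
  let ?f = "\<lambda>D Q. of_real (- 1 / sqrt pi) *
      (of_real (sgn (qtau Q \<tau>)) * qeval Q \<tau> ^ (k - 1) *
        of_real (inc_Gamma (1/2) (4 * pi * (qtau Q \<tau>)\<^sup>2 * Im z))) * qexp D z"
  have "Psi_star k \<tau> z = (\<Sum>\<^sub>\<infinity>D\<in>UNIV. \<Sum>\<^sub>\<infinity>Q\<in>forms_of_disc D. ?f D Q)"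
    unfolding Psi_star_def compl_form_def infsum_cmult_left' infsum_cmult_right' ..
  also have "\<dots> = infsum ?G {Q. disc Q \<in> UNIV}"
  proof (rule infsum_by_disc)
    show "?G summable_on {Q. disc Q \<in> UNIV}"
      by (subst infsum_nonzero_forms(2)) (use S G0 in auto)
    show "?f (disc Q) Q = ?G Q" for Q
      by (simp add: gamma_part_def)
  qed
  also have "\<dots> = infsum ?G (- {(0, 0, 0)})"
    by (rule infsum_nonzero_forms) (use G0 in auto)
  finally show "Psi_star k \<tau> z = infsum ?G (- {(0, 0, 0)})" .
qed

lemma Psi_hat_eq: "Psi_hat k \<tau> z = (\<Sum>\<^sub>\<infinity>Q\<in>- {(0, 0, 0)}. pterm k Q \<tau> z)"
  unfolding Psi_hat_def Psi_eq(2) Psi_star_eq(2) infsum_add[OF Psi_eq(1) Psi_star_eq(1), symmetric]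
proof (rule infsum_cong)
  fix Q :: qform
  show "qeval Q \<tau> ^ (k - 1) * (if disc Q > 0 then of_real (psi_part k (disc Q) (qtau Q \<tau>)) * qexp (disc Q) z else 0) +
    qeval Q \<tau> ^ (k - 1) * (of_real (gamma_part (qtau Q \<tau>) (Im z)) * qexp (disc Q) z) = pterm k Q \<tau> z"
    using pfun_eq[of k "Im z" "disc Q" "qtau Q \<tau>"] k z by (simp add: pterm_def algebra_simps)
qed

text \<open>The weights match because v^2 * (\<i> / 2) * (2 / sqrt v) = \<i> v^(3/2).\<close>

lemma Theta1_eq:
  "of_real ((Im z)\<^sup>2) * (\<Sum>\<^sub>\<infinity>Q\<in>- {(0, 0, 0)}. \<i> / 2 * dz_nonhol k Q \<tau> z) = Theta1 k \<tau> z"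
proof -
  let ?g = "\<lambda>Q. qeval Q \<tau> ^ (k - 1) * of_real (qtau Q \<tau>) *
        of_real (exp (- 4 * pi * (qtau Q \<tau>)\<^sup>2 * Im z)) * qexp (disc Q) z"
  have g: "dz_nonhol k Q \<tau> z = of_real (2 / sqrt (Im z)) * ?g Q" for Q
    by (simp add: dz_nonhol_def pfun_v_def)
  have g0: "?g (0, 0, 0) = 0" using k by simp
  have "(\<lambda>Q. dz_nonhol k Q \<tau> z) summable_on - {(0, 0, 0)}"
    by (rule decay_nonzero_summable[OF decay_pterm(2)]) (use k in simp)
  then have S: "?g summable_on - {(0, 0, 0)}"
    unfolding g by (subst (asm) summable_on_cmult_right') (use z in auto)
  have "(\<Sum>\<^sub>\<infinity>D\<in>UNIV. \<Sum>\<^sub>\<infinity>Q\<in>forms_of_disc D.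
        qeval Q \<tau> ^ (k - 1) * of_real (qtau Q \<tau>) *
        of_real (exp (- 4 * pi * (qtau Q \<tau>)\<^sup>2 * Im z)) * qexp D z) = infsum ?g {Q. disc Q \<in> UNIV}"
  proof (rule infsum_by_disc)
    show "?g summable_on {Q. disc Q \<in> UNIV}"
      by (subst infsum_nonzero_forms(2)) (use S g0 in auto)
  qed simp
  also have "\<dots> = infsum ?g (- {(0, 0, 0)})"
    by (rule infsum_nonzero_forms) (use g0 in auto)
  finally have T: "Theta1 k \<tau> z = \<i> * of_real (Im z powr (3/2)) * infsum ?g (- {(0, 0, 0)})"
    unfolding Theta1_def by simp
  have "Im z powr (3/2) = Im z powr (2 - 1/2)" by simp
  also have "\<dots> = (Im z)\<^sup>2 / sqrt (Im z)"
    using z by (simp only: powr_diff) (simp add: powr_half_sqrt powr_numeral)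
  finally have p: "Im z powr (3/2) = (Im z)\<^sup>2 / sqrt (Im z)" .
  show ?thesis
    unfolding T p g infsum_cmult_right' by simp
qed

lemma Theta_star_eq:
  "(\<lambda>Q. qeval Q \<tau> ^ k * (of_real (exp (- 4 * pi * (qtau Q \<tau>)\<^sup>2 * Im z)) * qexp (disc Q) z))
     summable_on - {(0, 0, 0)}"
  "Theta_star k \<tau> z = 2 * \<i> * of_real (sqrt (Im z)) * of_real (Im \<tau> powi (- 2 * int k)) *
     (\<Sum>\<^sub>\<infinity>Q\<in>- {(0, 0, 0)}. qeval Q \<tau> ^ k *
       (of_real (exp (- 4 * pi * (qtau Q \<tau>)\<^sup>2 * Im z)) * qexp (disc Q) z))"
proof -
  let ?g = "\<lambda>Q. qeval Q \<tau> ^ k * (of_real (exp (- 4 * pi * (qtau Q \<tau>)\<^sup>2 * Im z)) * qexp (disc Q) z)"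
  have g0: "?g (0, 0, 0) = 0" using k by simp
  have "decay (- real k) (\<lambda>Q \<tau> z. qeval Q \<tau> ^ k *
      (of_real (exp (- 4 * pi * (qtau Q \<tau>)\<^sup>2 * Im z)) * qexp (disc Q) z))"
    by (rule decay_qeval_pow[OF decay_gauss[of "- 2 * real k"]]) simp
  from decay_nonzero_summable[OF this] show S: "?g summable_on - {(0, 0, 0)}" .
  have "(\<Sum>\<^sub>\<infinity>D\<in>UNIV. \<Sum>\<^sub>\<infinity>Q\<in>forms_of_disc D.
        qeval Q \<tau> ^ k * of_real (exp (- 4 * pi * (qtau Q \<tau>)\<^sup>2 * Im z)) * qexp D z)
      = infsum ?g {Q. disc Q \<in> UNIV}"
  proof (rule infsum_by_disc)
    show "?g summable_on {Q. disc Q \<in> UNIV}"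
      by (subst infsum_nonzero_forms(2)) (use S g0 in auto)
  qed simp
  also have "\<dots> = infsum ?g (- {(0, 0, 0)})"
    by (rule infsum_nonzero_forms) (use g0 in auto)
  finally show "Theta_star k \<tau> z = 2 * \<i> * of_real (sqrt (Im z)) * of_real (Im \<tau> powi (- 2 * int k)) *
      infsum ?g (- {(0, 0, 0)})"
    unfolding Theta_star_def using z by (simp add: powr_half_sqrt)
qed

text \<open>Expand the inverse power of the conjugate by \<open>qeval Q \<tau> ^ k\<close> and use
  |Q(\<tau>,1)|^2 = y^2 (D + q^2). This is where the factor y^(-2k) of the second identity
  originates.\<close>

lemma powi_cnj_qeval:
  assumes "disc Q > 0"
  shows "cnj (qeval Q \<tau>) powi (- int k) =
    of_real (Im \<tau> powi (- 2 * int k)) * (qeval Q \<tau> ^ k * of_real (1 / (of_int (disc Q) + (qtau Q \<tau>)\<^sup>2) ^ k))"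
proof -
  have nz: "qeval Q \<tau> \<noteq> 0" by (rule qeval_nonzero[OF \<tau> assms])
  have y: "Im \<tau> powi (- 2 * int k) = inverse (((Im \<tau>)\<^sup>2) ^ k)"
    by (simp add: power_int_def power_mult nat_mult_distrib power_inverse)
  have "(qeval Q \<tau> * cnj (qeval Q \<tau>)) ^ k = of_real (((cmod (qeval Q \<tau>))\<^sup>2) ^ k)"
    by (subst of_real_power, subst complex_norm_square) (rule refl)
  then have "qeval Q \<tau> ^ k * cnj (qeval Q \<tau>) ^ k =
      of_real (((Im \<tau>)\<^sup>2) ^ k * (of_int (disc Q) + (qtau Q \<tau>)\<^sup>2) ^ k)"
    unfolding cmod_qeval_square[OF \<tau>] power_mult_distrib .
  moreover have "inverse (cnj (qeval Q \<tau>) ^ k) =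
      qeval Q \<tau> ^ k * inverse (qeval Q \<tau> ^ k * cnj (qeval Q \<tau>) ^ k)"
    using nz by (simp add: field_simps)
  ultimately have "inverse (cnj (qeval Q \<tau>) ^ k) = qeval Q \<tau> ^ k *
      inverse (of_real (((Im \<tau>)\<^sup>2) ^ k * (of_int (disc Q) + (qtau Q \<tau>)\<^sup>2) ^ k))"
    by (simp only:)
  then show ?thesis
    unfolding y power_int_minus power_int_of_nat of_real_mult inverse_mult_distrib of_real_inverse
    by (simp add: divide_inverse)
qed

lemma Omega_eq:
  "(\<lambda>Q. qeval Q \<tau> ^ k * (if disc Q > 0 then of_real (of_int (disc Q) powr (real k - 1/2) /
      (of_int (disc Q) + (qtau Q \<tau>)\<^sup>2) ^ k) * qexp (disc Q) z else 0)) summable_on - {(0, 0, 0)}"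
  "Omega k (- cnj \<tau>) z = of_real (Im \<tau> powi (- 2 * int k)) *
     (\<Sum>\<^sub>\<infinity>Q\<in>- {(0, 0, 0)}. qeval Q \<tau> ^ k * (if disc Q > 0 then of_real (of_int (disc Q) powr (real k - 1/2) /
      (of_int (disc Q) + (qtau Q \<tau>)\<^sup>2) ^ k) * qexp (disc Q) z else 0))"
proof -
  let ?Y = "complex_of_real (Im \<tau> powi (- 2 * int k))"
  let ?g = "\<lambda>Q. qeval Q \<tau> ^ k * (if disc Q > 0 then of_real (of_int (disc Q) powr (real k - 1/2) /
      (of_int (disc Q) + (qtau Q \<tau>)\<^sup>2) ^ k) * qexp (disc Q) z else 0)"
  have "decay (- real k) (\<lambda>Q \<tau> z. qeval Q \<tau> ^ k * (if disc Q > 0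
     then of_real (of_int (disc Q) powr (real k - 1/2) / (of_int (disc Q) + (qtau Q \<tau>)\<^sup>2) ^ k) * qexp (disc Q) z else 0))"
    by (rule decay_qeval_pow[OF decay_cauchy_part]) simp
  from decay_nonzero_summable[OF this] show S: "?g summable_on - {(0, 0, 0)}" .
  let ?f = "\<lambda>D Q. of_real (of_int D powr (real k - 1/2)) * cnj (qeval Q \<tau>) powi (- int k) * qexp D z"
  have "(\<Sum>\<^sub>\<infinity>Q\<in>forms_of_disc D. qeval Q (- cnj \<tau>) powi (- int k)) =
      (\<Sum>\<^sub>\<infinity>Q\<in>forms_of_disc D. cnj (qeval Q \<tau>) powi (- int k))" for D
    by (rule infsum_reindex_bij_witness[where i = "\<lambda>(a, b, c). (a, - b, c)" and j = "\<lambda>(a, b, c). (a, - b, c)"])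
       (auto simp: disc_def qeval_neg_cnj[symmetric])
  then have "Omega k (- cnj \<tau>) z = (\<Sum>\<^sub>\<infinity>D\<in>{0<..}. \<Sum>\<^sub>\<infinity>Q\<in>forms_of_disc D. ?f D Q)"
    unfolding Omega_def hyp_poincare_def infsum_cmult_left' infsum_cmult_right' by simp
  also have "\<dots> = infsum (\<lambda>Q. ?Y * ?g Q) {Q. disc Q \<in> {0<..}}"
  proof (rule infsum_by_disc)
    have "?g summable_on {Q. disc Q \<in> {0<..}}"
      by (subst infsum_nonzero_forms(2)) (use S in \<open>auto simp: disc_def\<close>)
    then show "(\<lambda>Q. ?Y * ?g Q) summable_on {Q. disc Q \<in> {0<..}}"
      by (rule summable_on_cmult_right)
    fix Q assume "disc Q \<in> {0<..}"
    then have D: "disc Q > 0" by simp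
    show "?f (disc Q) Q = ?Y * ?g Q"
      unfolding powi_cnj_qeval[OF D] of_real_divide using D by simp
  qed
  also have "\<dots> = ?Y * infsum ?g {Q. disc Q \<in> {0<..}}"
    by (rule infsum_cmult_right')
  also have "infsum ?g {Q. disc Q \<in> {0<..}} = infsum ?g (- {(0, 0, 0)})"
    by (rule infsum_nonzero_forms) (auto simp: disc_def)
  finally show "Omega k (- cnj \<tau>) z = ?Y * infsum ?g (- {(0, 0, 0)})" .
qed


lemma dtau_nonhol_eq:
  "qeval Q \<tau> * dtau_nonhol k Q \<tau> z =
    of_real (4 * sqrt (Im z)) * (qeval Q \<tau> ^ k *
      (of_real (exp (- 4 * pi * (qtau Q \<tau>)\<^sup>2 * Im z)) * qexp (disc Q) z)) -
    of_real (2 / beta_half k) * (qeval Q \<tau> ^ k * (if disc Q > 0 then of_real (of_int (disc Q) powr (real k - 1/2) /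
      (of_int (disc Q) + (qtau Q \<tau>)\<^sup>2) ^ k) * qexp (disc Q) z else 0))"
proof -
  have "qeval Q \<tau> * dtau_nonhol k Q \<tau> z =
      qeval Q \<tau> ^ k * (of_real (pfun_q k (disc Q) (qtau Q \<tau>) (Im z)) * qexp (disc Q) z)"
    using power_Suc[of "qeval Q \<tau>" "k - 1"] k unfolding dtau_nonhol_def mult.assoc[symmetric]
    by simp
  also have "of_real (pfun_q k (disc Q) (qtau Q \<tau>) (Im z)) * qexp (disc Q) z =
    of_real (4 * sqrt (Im z)) * (of_real (exp (- 4 * pi * (qtau Q \<tau>)\<^sup>2 * Im z)) * qexp (disc Q) z) -
      of_real (2 / beta_half k) * (if disc Q > 0
       then of_real (of_int (disc Q) powr (real k - 1/2) / (of_int (disc Q) + (qtau Q \<tau>)\<^sup>2) ^ k) * qexp (disc Q) z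
       else 0)"
    by (cases "disc Q > 0"; simp only: pfun_q_def if_True if_False of_real_diff of_real_mult
         left_diff_distrib mult_zero_right diff_0_right mult.assoc of_real_0)
  finally show ?thesis
    by (simp only: right_diff_distrib mult.left_commute)
qed

text \<open>The factor - \<i> / 2 meets 4 sqrt v in the Gaussian summand and - 2 / \<beta> in the
  rational one, giving - 2 \<i> sqrt v for \<open>Theta_star\<close> and \<i> / \<beta> for
  \<open>Omega\<close>.\<close>

lemma lowering_tau_eq:
  "of_real (Im \<tau> powi (- 2 * int k)) * (\<Sum>\<^sub>\<infinity>Q\<in>- {(0, 0, 0)}. - \<i> / 2 * (qeval Q \<tau> * dtau_nonhol k Q \<tau> z)) =
    \<i> / of_real (beta_half k) * Omega k (- cnj \<tau>) z - Theta_star k \<tau> z"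
proof -
  let ?g = "\<lambda>Q. qeval Q \<tau> ^ k * (if disc Q > 0 then of_real (of_int (disc Q) powr (real k - 1/2) /
      (of_int (disc Q) + (qtau Q \<tau>)\<^sup>2) ^ k) * qexp (disc Q) z else 0)"
  let ?h = "\<lambda>Q. qeval Q \<tau> ^ k * (of_real (exp (- 4 * pi * (qtau Q \<tau>)\<^sup>2 * Im z)) * qexp (disc Q) z)"
  have "(\<Sum>\<^sub>\<infinity>Q\<in>- {(0, 0, 0)}. - \<i> / 2 * (qeval Q \<tau> * dtau_nonhol k Q \<tau> z)) =
     (\<Sum>\<^sub>\<infinity>Q\<in>- {(0, 0, 0)}. (- 2 * \<i> * of_real (sqrt (Im z))) * ?h Q + (\<i> / of_real (beta_half k)) * ?g Q)"
  proof (rule infsum_cong)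
    fix Q :: qform
    have "- \<i> / 2 * (of_real (4 * s) * H - of_real (2 / b) * G) =
        (- 2 * \<i> * of_real s) * H + (\<i> / of_real b) * G" for s b and G H :: complex
      by (simp add: algebra_simps)
    then show "- \<i> / 2 * (qeval Q \<tau> * dtau_nonhol k Q \<tau> z) =
       (- 2 * \<i> * of_real (sqrt (Im z))) * ?h Q + (\<i> / of_real (beta_half k)) * ?g Q"
      unfolding dtau_nonhol_eq .
  qed
  also have "\<dots> = (- 2 * \<i> * of_real (sqrt (Im z))) * infsum ?h (- {(0, 0, 0)}) +
      (\<i> / of_real (beta_half k)) * infsum ?g (- {(0, 0, 0)})"
    unfolding infsum_cmult_right'[symmetric]
    by (rule infsum_add) (intro summable_on_cmult_right Theta_star_eq(1) Omega_eq(1))+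
  finally show ?thesis
    unfolding Theta_star_eq(2) Omega_eq(2) by (simp only:) (simp add: algebra_simps)
qed

end

theorem theorem1p2:
  fixes k :: nat and \<tau> z :: complex
  assumes "k \<ge> 4" and "even k" and "Im \<tau> > 0" and "Im z > 0"
  shows "((\<lambda>z'. Psi_hat k \<tau> z') differentiable (at z) \<and>
          lowering (\<lambda>z'. Psi_hat k \<tau> z') z = Theta1 k \<tau> z) \<and>
         ((\<lambda>\<tau>'. Psi_hat k \<tau>' z) differentiable (at \<tau>) \<and>
          of_real (Im \<tau> powi (- 2 * int k)) * lowering (\<lambda>\<tau>'. Psi_hat k \<tau>' z) \<tau> =
            \<i> / of_real (beta_fun (real k - 1/2) (1/2)) * Omega k (- cnj \<tau>) z
            - Theta_star k \<tau> z)"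
proof (intro conjI)
  interpret region "Im \<tau> / 2" "cmod \<tau> + 1" "Im z / 2" "Im z + 1"
    using assms by unfold_locales auto
  have dz: "((\<lambda>z'. Psi_hat k \<tau> z') has_derivative
      (\<lambda>h. \<Sum>\<^sub>\<infinity>Q\<in>- {(0, 0, 0)}. dz_nonhol k Q \<tau> z * of_real (Im h) + dz_hol k Q \<tau> z * h)) (at z)"
  \<comment> \<open>The single series represents \<open>Psi_hat\<close> on the upper half-plane
    only; openness suffices for a derivative at z.\<close>
  proof (rule has_derivative_transform_within_open[OF sum_pterm_has_derivative_z(2) open_halfspace_Im_gt[of 0]])
    show "(\<Sum>\<^sub>\<infinity>Q\<in>- {(0, 0, 0)}. pterm k Q \<tau> w) = Psi_hat k \<tau> w" if "w \<in> {z. 0 < Im z}" for w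
      using that assms by (intro Psi_hat_eq[symmetric]) auto
  qed (use assms in auto)
  then show "(\<lambda>z'. Psi_hat k \<tau> z') differentiable (at z)"
    by (rule differentiableI)
  have "dbar (\<lambda>z'. Psi_hat k \<tau> z') z = (\<Sum>\<^sub>\<infinity>Q\<in>- {(0, 0, 0)}. \<i> / 2 * dz_nonhol k Q \<tau> z)"
  proof (subst dbar_infsum[OF dz])
    show "(\<lambda>Q. dz_nonhol k Q \<tau> z * of_real (Im h) + dz_hol k Q \<tau> z * h) summable_on - {(0, 0, 0)}" for h
      by (rule sum_pterm_has_derivative_z(1)) (use assms in auto)
  qed (auto intro!: infsum_cong simp: algebra_simps)
  then show "lowering (\<lambda>z'. Psi_hat k \<tau> z') z = Theta1 k \<tau> z"
    unfolding lowering_def using Theta1_eq[of k \<tau> z] assms by simp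
  have dt: "((\<lambda>\<tau>'. Psi_hat k \<tau>' z) has_derivative (\<lambda>h. \<Sum>\<^sub>\<infinity>Q\<in>- {(0, 0, 0)}.
      dtau_nonhol k Q \<tau> z * of_real (Im (qeval Q \<tau> * cnj h) / (Im \<tau>)\<^sup>2) + dtau_hol k Q \<tau> z * h)) (at \<tau>)"
  proof (rule has_derivative_transform_within_open[OF sum_pterm_has_derivative_tau(2) open_halfspace_Im_gt[of 0]])
    show "(\<Sum>\<^sub>\<infinity>Q\<in>- {(0, 0, 0)}. pterm k Q w z) = Psi_hat k w z" if "w \<in> {\<tau>. 0 < Im \<tau>}" for w
      using that assms by (intro Psi_hat_eq[symmetric]) auto
  qed (use assms in auto)
  then show "(\<lambda>\<tau>'. Psi_hat k \<tau>' z) differentiable (at \<tau>)"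
    by (rule differentiableI)
  have "dbar (\<lambda>\<tau>'. Psi_hat k \<tau>' z) \<tau> =
      (\<Sum>\<^sub>\<infinity>Q\<in>- {(0, 0, 0)}. of_real (inverse ((Im \<tau>)\<^sup>2)) * (- \<i> / 2 * (qeval Q \<tau> * dtau_nonhol k Q \<tau> z)))"
  proof (subst dbar_infsum[OF dt])
    show "(\<lambda>Q. dtau_nonhol k Q \<tau> z * of_real (Im (qeval Q \<tau> * cnj h) / (Im \<tau>)\<^sup>2) + dtau_hol k Q \<tau> z * h)
        summable_on - {(0, 0, 0)}" for h
      by (rule sum_pterm_has_derivative_tau(1)) (use assms in auto)
    \<comment> \<open>The e terms cancel and the d terms combine to - \<i> q / t; with t = y^2 this
      factor is cancelled by the one in \<open>lowering\<close>.\<close>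
    have "(d * of_real (Im (q * cnj 1) / t) + e * 1 + \<i> * (d * of_real (Im (q * cnj \<i>) / t) + e * \<i>)) / 2 =
        of_real (inverse t) * (- \<i> / 2 * (q * d))" for d q e :: complex and t :: real
    proof -
      have "d * of_real (Im (q * cnj 1) / t) + e * 1 + \<i> * (d * of_real (Im (q * cnj \<i>) / t) + e * \<i>) =
          d * (of_real (inverse t) * (of_real (Im q) - \<i> * of_real (Re q)))"
        by (simp add: algebra_simps divide_inverse)
      also have "of_real (Im q) - \<i> * of_real (Re q) = - \<i> * q"
        by (simp add: complex_eq_iff)
      finally show ?thesis by simp
    qed
    then show "(\<Sum>\<^sub>\<infinity>Q\<in>- {(0, 0, 0)}.
        (dtau_nonhol k Q \<tau> z * of_real (Im (qeval Q \<tau> * cnj 1) / (Im \<tau>)\<^sup>2) + dtau_hol k Q \<tau> z * 1 +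
         \<i> * (dtau_nonhol k Q \<tau> z * of_real (Im (qeval Q \<tau> * cnj \<i>) / (Im \<tau>)\<^sup>2) + dtau_hol k Q \<tau> z * \<i>)) / 2) =
      (\<Sum>\<^sub>\<infinity>Q\<in>- {(0, 0, 0)}. of_real (inverse ((Im \<tau>)\<^sup>2)) * (- \<i> / 2 * (qeval Q \<tau> * dtau_nonhol k Q \<tau> z)))"
      by (intro infsum_cong)
  qed
  then have "dbar (\<lambda>\<tau>'. Psi_hat k \<tau>' z) \<tau> = of_real (inverse ((Im \<tau>)\<^sup>2)) *
      (\<Sum>\<^sub>\<infinity>Q\<in>- {(0, 0, 0)}. - \<i> / 2 * (qeval Q \<tau> * dtau_nonhol k Q \<tau> z))"
    unfolding infsum_cmult_right' .
  then have "lowering (\<lambda>\<tau>'. Psi_hat k \<tau>' z) \<tau> =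
      (\<Sum>\<^sub>\<infinity>Q\<in>- {(0, 0, 0)}. - \<i> / 2 * (qeval Q \<tau> * dtau_nonhol k Q \<tau> z))"
    unfolding lowering_def using assms(3) by simp
  then show "of_real (Im \<tau> powi (- 2 * int k)) * lowering (\<lambda>\<tau>'. Psi_hat k \<tau>' z) \<tau> =
      \<i> / of_real (beta_half k) * Omega k (- cnj \<tau>) z - Theta_star k \<tau> z"
    using lowering_tau_eq[of k \<tau> z] assms by (simp only:)
qed

end
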